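(* For $q\in(0,1)$ suppose that $a,b,c$ are non-negative real numbers satisfying $0\le q(b-c)\le 1-cq$ and $0<a-c\le 1-c$. Then there exists a non-decreasing function $\mu:[0,1]\to[0,1]$ with $\mu(1)-\mu(0)=1$ such that $$\frac{z\,\Phi[a,bq;cq;q,z]}{\Phi[a,b;c;q,z]}=\int_0^1\frac{qz}{q-tz}\,d\mu(t),$$ which is analytic in the cut-plane $\mathbb{C}\setminus[q,\infty]$ and maps both the unit disk $\mathbb{D}$ and the half-plane $\{z\in\mathbb{C}:\mathrm{Re}\,z<q\}$ univalently onto domains convex in the direction of the imaginary axis.
   Context: $\mathbb{D}=\{z\in\mathbb{C}:|z|<1\}$ is the unit disk. The $q$-shifted factorial is $(a;q)_0=1$, $(a;q)_n=(1-a)(1-aq)\cdots(1-aq^{n-1})$ for $n\ge1$. Heine's basic hypergeometric function $\Phi[a,b;c;q,z]$ is the function given in the unit disk by the series $$\Phi[a,b;c;q,z]=\sum_{n=0}^\infty\frac{(a;q)_n(b;q)_n}{(c;q)_n(q;q)_n}z^n.$$ A domain $D\subset\mathbb{C}$ is called convex in the direction of the imaginary axis if the intersection of $D$ with any line parallel to the imaginary axis is either empty or a line segment. The set $\mathbb{C}\setminus[q,\infty]$ is the complex plane cut along the real ray from $q$ to $\infty$. "Univalently" means by a one-to-one analytic function. The integral is a Stieltjes integral.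
   Formalization: The claim for the unit disk fails if Φ[a,b;c;q,z] has a zero there (e.g. q=1/2, a=1/10, b=2, c=0: pole at 5/9); it is proved for 𝔻 when Φ[a,b;c;q,z] has no zero in 𝔻, and always for |z|<q; the identity is proved on 𝔻 minus [q,1). *)

theory Defs
  imports "HOL-Complex_Analysis.Complex_Analysis"
begin

definition q_shifted_fact :: "'a::comm_ring_1 \<Rightarrow> 'a \<Rightarrow> nat \<Rightarrow> 'a" where
  "q_shifted_fact a q n = (\<Prod>k<n. 1 - a * q ^ k)"

text \<open>Only meaningful for \<open>norm z < 1\<close>, where the series converges; outside the unit disk
  \<open>suminf\<close> is in general an unspecified value.\<close>

definition heine_Phi :: "complex \<Rightarrow> complex \<Rightarrow> complex \<Rightarrow> complex \<Rightarrow> complex \<Rightarrow> complex" where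
  "heine_Phi a b c q z =
     (\<Sum>n. q_shifted_fact a q n * q_shifted_fact b q n /
           (q_shifted_fact c q n * q_shifted_fact q q n) * z ^ n)"

text \<open>The Riemann--Stieltjes integral, as the limit of the sums
  \<open>\<Sum> f(\<xi>\<^sub>i) (\<mu>(t\<^sub>i\<^sub>+\<^sub>1) - \<mu>(t\<^sub>i))\<close> as the mesh tends to \<open>0\<close>. The gauge is the
  constant one of radius \<open>d\<close>, so it is not the Henstock variant. No one-sided continuity of
  \<open>\<mu>\<close> is assumed; in particular a jump at the left endpoint counts, which would be lost in the
  measure obtained from the right-continuous version of \<open>\<mu>\<close>. Degenerate intervals
  contribute \<open>0\<close>.\<close>

definition has_stieltjes_integral ::
    "(real \<Rightarrow> 'a::real_normed_vector) \<Rightarrow> (real \<Rightarrow> real) \<Rightarrow> real \<Rightarrow> real \<Rightarrow> 'a \<Rightarrow> bool" where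
  "has_stieltjes_integral f \<mu> a b I \<longleftrightarrow>
     (\<forall>e>0. \<exists>d>0. \<forall>p. p tagged_division_of {a..b} \<and> (\<lambda>x. ball x d) fine p \<longrightarrow>
        norm ((\<Sum>(x, K)\<in>p. (\<mu> (Sup K) - \<mu> (Inf K)) *\<^sub>R f x) - I) < e)"

definition stieltjes_integrable ::
    "(real \<Rightarrow> 'a::real_normed_vector) \<Rightarrow> (real \<Rightarrow> real) \<Rightarrow> real \<Rightarrow> real \<Rightarrow> bool" where
  "stieltjes_integrable f \<mu> a b \<longleftrightarrow> (\<exists>I. has_stieltjes_integral f \<mu> a b I)"

definition stieltjes_integral ::
    "(real \<Rightarrow> 'a::real_normed_vector) \<Rightarrow> (real \<Rightarrow> real) \<Rightarrow> real \<Rightarrow> real \<Rightarrow> 'a" where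
  "stieltjes_integral f \<mu> a b = (THE I. has_stieltjes_integral f \<mu> a b I)"

definition cut_plane :: "real \<Rightarrow> complex set" where
  "cut_plane q = - (complex_of_real ` {q..})"

text \<open>The last conjunct says that every vertical slice is empty or a line segment, where a segment
  may be open and may be unbounded (a ray or the whole line): these, the empty set and points are
  the convex subsets of a line.\<close>

definition domain_convex_imag_dir :: "complex set \<Rightarrow> bool" where
  "domain_convex_imag_dir D \<longleftrightarrow>
     open D \<and> connected D \<and> D \<noteq> {} \<and> (\<forall>x. convex (D \<inter> {w. Re w = x}))"

definition maps_univalently_onto_convex_imag ::
    "(complex \<Rightarrow> complex) \<Rightarrow> complex set \<Rightarrow> bool" where
  "maps_univalently_onto_convex_imag f S \<longleftrightarrow>
     f analytic_on S \<and> inj_on f S \<and> domain_convex_imag_dir (f ` S)"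

end

theory Submission
  imports Defs "HOL-Probability.Probability"
begin

text \<open>
  Put \<open>\<Phi>\<^sub>0 = \<Phi>[a,b;c;q,\<cdot>]\<close>, and let \<open>\<Phi>\<^sub>k\<^sub>+\<^sub>1\<close> arise from \<open>\<Phi>\<^sub>k\<close> by
  replacing the parameters \<open>(a,b,c)\<close> with \<open>(bq,a,cq)\<close>; by symmetry in the first two parameters
  \<open>\<Phi>\<^sub>1\<close> is the numerator of the quotient. Heine's contiguous relation reads
  \<open>\<Phi>\<^sub>k = \<Phi>\<^sub>k\<^sub>+\<^sub>1 - d\<^sub>k z \<Phi>\<^sub>k\<^sub>+\<^sub>2\<close> with \<open>q d\<^sub>k = (1 - g\<^sub>k) g\<^sub>k\<^sub>+\<^sub>1\<close>, where \<open>g\<^sub>k\<close> is the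
  value of \<open>(a - c)/(1 - c)\<close> at the \<open>k\<close>-th parameters (\<open>heine_contiguous\<close>). The hypotheses put
  every \<open>g\<^sub>k\<close> into \<open>[0,1]\<close>, and this condition survives the replacement of parameters.

  In the variable \<open>w = z/q\<close> the quotient \<open>\<Phi>\<^sub>1/\<Phi>\<^sub>0\<close> is therefore the continued fraction with
  coefficients \<open>(1 - g\<^sub>k) g\<^sub>k\<^sub>+\<^sub>1\<close>. Its Taylor coefficients are \<open>m\<^sub>n = \<langle>e, T\<^sup>2\<^sup>n e\<rangle>\<close>, where \<open>T\<close> is
  the symmetric tridiagonal matrix with zero diagonal and off-diagonal entries
  \<open>sqrt ((1 - g\<^sub>k) g\<^sub>k\<^sub>+\<^sub>1)\<close> and \<open>e\<close> is the first basis vector (\<open>chain_fraction_moments\<close>). The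
  Cauchy--Schwarz inequality with the weights \<open>g\<^sub>k\<close> and \<open>1 - g\<^sub>k\<close> shows that \<open>T\<close> is a contraction,
  so \<open>T\<^sup>2\<close> and \<open>1 - T\<^sup>2\<close> are commuting nonnegative operators and \<open>m\<close> is completely monotone.
  Hausdorff's theorem (\<open>hausdorff_moment_problem\<close>) provides a random variable with values in
  \<open>[0,1]\<close> and moments \<open>m\<^sub>n\<close>; after division by \<open>q\<close> it is called \<open>X\<close>, and
  \<open>z \<Phi>\<^sub>1(z) = \<Phi>\<^sub>0(z) F(z)\<close> with \<open>F(z) = E[z/(1 - Xz)]\<close> near \<open>0\<close>. Up to its value at \<open>0\<close> the
  function \<open>\<mu>\<close> is the distribution function of \<open>qX\<close>.

  The identity extends to the unit disc slit along \<open>[q,1)\<close>. There \<open>\<Phi>\<^sub>0\<close> has no zero: a zero of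
  \<open>\<Phi>\<^sub>0\<close> would be a zero of every \<open>\<Phi>\<^sub>k\<close>, but \<open>\<Phi>\<^sub>2\<^sub>k\<close> converges to \<open>E = \<Phi>[0,0;0;q,\<cdot>]\<close>, which has no
  zeros in the disc because \<open>(1 - z) E(z) = E(qz)\<close> and \<open>E(0) = 1\<close> (\<open>heine_fun_nonzero\<close>).

  The mapping properties hold for every \<open>F(z) = E[z/(1 - Xz)]\<close> with \<open>0 \<le> X \<le> 1/\<rho>\<close>, on
  \<open>Re z < \<rho>\<close> and on \<open>|z| < \<rho>\<close>. The divided difference of \<open>F\<close> is the mean of
  \<open>1/((1 - Xz)(1 - Xw))\<close>, whose values lie in an open half-plane bounded by a line through \<open>0\<close>
  that depends only on \<open>z\<close> and \<open>w\<close>; this gives injectivity. If \<open>X = 0\<close> almost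
  surely, then \<open>F\<close> is the identity; otherwise \<open>Re F\<close> strictly decreases in the upper half-plane along upward vertical rays, so a level curve of \<open>Re F\<close> is a graph over a horizontal
  interval, and followed to the left it reaches the real axis (\<open>level_curve\<close>). Along it \<open>Im F\<close>
  takes all values between the starting value and \<open>0\<close>, and reflection in the real axis supplies
  the rest of the vertical segment. On a circle about \<open>0\<close> the function \<open>Re F\<close> is strictly
  monotone in \<open>Re z\<close>, so the level curve cannot leave a disc in which it starts, which settles
  the case of the disc (\<open>slice_below_attained\<close>).

  Finally, if \<open>\<Phi>\<^sub>0\<close> has no zero in the whole unit disc, then the Taylor series of the quotient
  converges there. The moments of \<open>X\<close> then decay so fast that \<open>X \<le> 1\<close> almost surely, and the
  result for discs applies with \<open>\<rho> = 1\<close> (\<open>extension_univalent_convex\<close>).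
\<close>

section \<open>Completely monotone sequences and the Hausdorff moment problem\<close>

definition decrement :: "(nat \<Rightarrow> real) \<Rightarrow> nat \<Rightarrow> real" where
  "decrement f n = f n - f (Suc n)"

definition completely_monotone :: "(nat \<Rightarrow> real) \<Rightarrow> bool" where
  "completely_monotone f \<longleftrightarrow> (\<forall>k n. 0 \<le> (decrement ^^ k) f n)"

lemma decrement_funpow_Suc:
  "(decrement ^^ Suc k) f n = (decrement ^^ k) f n - (decrement ^^ k) f (Suc n)"
  by (simp only: funpow.simps(2) o_apply) (rule decrement_def)

text \<open>The \<open>k\<close>-th difference at \<open>n\<close> sees only the terms from \<open>n\<close> to \<open>n + k\<close>, so complete
  monotonicity can be tested on truncations.\<close>

lemma decrement_cong:
  assumes "\<And>i. i \<le> k \<Longrightarrow> f (n + i) = h (n + i)"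
  shows "(decrement ^^ k) f n = (decrement ^^ k) h n"
  using assms
proof (induction k arbitrary: n)
  case 0
  show ?case using "0.prems"[of 0] by simp
next
  case (Suc k)
  have "(decrement ^^ k) f n = (decrement ^^ k) h n"
    using Suc.prems by (intro Suc.IH) simp
  moreover have "(decrement ^^ k) f (Suc n) = (decrement ^^ k) h (Suc n)"
    using Suc.prems[of "Suc i" for i] by (intro Suc.IH) simp
  ultimately show ?case by (simp only: decrement_funpow_Suc)
qed

text \<open>With \<open>S\<close> the shift and \<open>D\<close> the difference operator this is the binomial expansion of \<open>(D
  + S)\<^sup>L = 1\<close>, proved by Pascal's rule.\<close>

lemma binomial_decrements:
  "(\<Sum>i\<le>L. real (L choose i) * (decrement ^^ (L - i)) f (n + i)) = f n"
proof (induction L)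
  case (Suc L)
  define t where "t i = (decrement ^^ (Suc L - i)) f (n + i)" for i
  have pascal: "t i + t (Suc i) = (decrement ^^ (L - i)) f (n + i)" if "i \<le> L" for i
  proof -
    have "Suc L - i = Suc (L - i)" using that by simp
    then show ?thesis unfolding t_def by (simp only: decrement_funpow_Suc) simp
  qed
  have "(\<Sum>i\<le>Suc L. real (Suc L choose i) * t i)
      = t 0 + (\<Sum>i\<le>L. real (L choose i) * t (Suc i)) + (\<Sum>i\<le>L. real (L choose Suc i) * t (Suc i))"
    by (simp add: sum.atMost_Suc_shift algebra_simps sum.distrib del: sum.atMost_Suc)
  also have "(\<Sum>i\<le>L. real (L choose Suc i) * t (Suc i)) = (\<Sum>i\<le>Suc L. real (L choose i) * t i) - t 0"
    by (simp add: sum.atMost_Suc_shift del: sum.atMost_Suc)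
  also have "(\<Sum>i\<le>Suc L. real (L choose i) * t i) = (\<Sum>i\<le>L. real (L choose i) * t i)"
    by simp
  finally have "(\<Sum>i\<le>Suc L. real (Suc L choose i) * t i) = (\<Sum>i\<le>L. real (L choose i) * (t i + t (Suc i)))"
    by (simp add: algebra_simps sum.distrib)
  also have "\<dots> = f n" using pascal Suc.IH by simp
  finally show ?case by (simp only: t_def)
qed simp

text \<open>If \<open>m\<close> is the moment sequence of a measure on \<open>[0,1]\<close>, this is the integral of the
  Bernstein polynomial \<open>(K choose j) t\<^sup>j (1 - t)\<^sup>K\<^sup>-\<^sup>j\<close>. The measures with these masses at \<open>j/K\<close>
  approximate the unknown measure.\<close>

definition bernstein_weight :: "(nat \<Rightarrow> real) \<Rightarrow> nat \<Rightarrow> nat \<Rightarrow> real" where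
  "bernstein_weight m K j = real (K choose j) * (decrement ^^ (K - j)) m j"

lemma bernstein_weight_nonneg: "completely_monotone m \<Longrightarrow> 0 \<le> bernstein_weight m K j"
  by (simp add: bernstein_weight_def completely_monotone_def)

text \<open>Factorial moments, unlike power moments, are reproduced exactly: \<open>(K choose j)(j choose
  n)\<close> equals \<open>(K choose n)(K - n choose j - n)\<close>, which reduces the sum to \<open>binomial_decrements\<close>.\<close>

lemma bernstein_weight_factorial_moment:
  assumes "n \<le> K"
  shows "(\<Sum>j\<le>K. bernstein_weight m K j * (real (j choose n) / real (K choose n))) = m n"
proof -
  have "(\<Sum>j\<le>K. bernstein_weight m K j * (real (j choose n) / real (K choose n)))
      = (\<Sum>j\<in>{n..K}. bernstein_weight m K j * (real (j choose n) / real (K choose n)))"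
    by (intro sum.mono_neutral_right) (auto simp: binomial_eq_0)
  also have "\<dots> = (\<Sum>j\<in>{n..K}. real ((K - n) choose (j - n)) * (decrement ^^ (K - j)) m j)"
  proof (intro sum.cong refl)
    fix j assume j: "j \<in> {n..K}"
    then have "real (K choose j) * real (j choose n) = real (K choose n) * real ((K - n) choose (j - n))"
      using choose_mult[of n j K] by (simp flip: of_nat_mult)
    moreover have "real (K choose n) \<noteq> 0" using assms by simp
    ultimately show "bernstein_weight m K j * (real (j choose n) / real (K choose n))
        = real ((K - n) choose (j - n)) * (decrement ^^ (K - j)) m j"
      by (simp add: bernstein_weight_def field_simps)
  qed
  also have "\<dots> = (\<Sum>i\<le>K - n. real ((K - n) choose i) * (decrement ^^ (K - n - i)) m (n + i))"
    using assms by (subst sum.atLeastAtMost_shift_0) (auto simp: atLeast0AtMost)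
  also have "\<dots> = m n" by (rule binomial_decrements)
  finally show ?thesis .
qed

text \<open>Both sides are products of \<open>n\<close> factors in \<open>[-1,1]\<close>, namely \<open>j/K\<close> and \<open>(j - l)/(K - l)\<close>
  for \<open>l < n\<close>, which are close factor by factor. Hence the exact factorial moments yield the
  power moments in the limit, uniformly in \<open>j\<close>.\<close>

lemma power_factorial_ratio_close:
  assumes "j \<le> K" "2 * n \<le> K" "0 < K"
  shows "\<bar>(real j / real K) ^ n - real (j choose n) / real (K choose n)\<bar> \<le> 2 * (real n)\<^sup>2 / real K"
proof -
  have prod: "real (i choose n) * fact n = (\<Prod>l\<in>{0..<n}. real i - real l)" for i
    using gbinomial_mult_fact'[of "real i" n] by (simp add: binomial_gbinomial)
  have "real (j choose n) / real (K choose n) = (real (j choose n) * fact n) / (real (K choose n) * fact n)"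
    by simp
  also have "\<dots> = (\<Prod>l\<in>{0..<n}. (real j - real l) / (real K - real l))"
    by (simp only: prod prod_dividef)
  finally have ratio: "real (j choose n) / real (K choose n) = (\<Prod>l\<in>{0..<n}. (real j - real l) / (real K - real l))" .
  have power: "(real j / real K) ^ n = (\<Prod>l\<in>{0..<n}. real j / real K)" by simp
  have "norm ((\<Prod>l\<in>{0..<n}. real j / real K) - (\<Prod>l\<in>{0..<n}. (real j - real l) / (real K - real l)))
      \<le> (\<Sum>l\<in>{0..<n}. norm (real j / real K - (real j - real l) / (real K - real l)))"
  proof (rule norm_prod_diff)
    fix l assume l: "l \<in> {0..<n}"
    have "\<bar>real j - real l\<bar> \<le> real K - real l" using assms l by auto
    moreover have "0 < real K - real l" using assms l by auto
    ultimately show "norm ((real j - real l) / (real K - real l)) \<le> 1" by (simp add: abs_div)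
  qed (use assms in auto)
  also have "\<dots> \<le> (\<Sum>l\<in>{0..<n}. 2 * real n / real K)"
  proof (rule sum_mono)
    fix l assume l: "l \<in> {0..<n}"
    have pos: "0 < real K - real l" using assms l by auto
    have "real j / real K - (real j - real l) / (real K - real l)
        = (real l / (real K - real l)) * ((real K - real j) / real K)"
      using pos assms by (simp add: field_simps)
    also have "norm \<dots> \<le> (real l / (real K - real l)) * 1"
      unfolding real_norm_def abs_mult using pos assms by (intro mult_mono) (auto simp: abs_div)
    also have "\<dots> \<le> 2 * real n / real K"
    proof -
      have "real l * real K \<le> 2 * real n * (real K - real l)"
      proof -
        have "real l * real K \<le> real n * real K" using l by (intro mult_right_mono) auto
        also have "\<dots> \<le> real n * (2 * (real K - real l))" using assms l by (intro mult_left_mono) auto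
        finally show ?thesis by (simp add: algebra_simps)
      qed
      then show ?thesis using pos assms by (simp add: field_simps)
    qed
    finally show "norm (real j / real K - (real j - real l) / (real K - real l)) \<le> 2 * real n / real K" .
  qed
  also have "\<dots> = 2 * (real n)\<^sup>2 / real K" by (simp add: power2_eq_square)
  finally show ?thesis by (simp only: ratio power real_norm_def)
qed

lemma bernstein_weight_moments_converge:
  assumes m: "completely_monotone m" and m0: "m 0 = 1"
  shows "(\<lambda>K. \<Sum>j\<le>Suc K. (real j / real (Suc K)) ^ n * bernstein_weight m (Suc K) j) \<longlonglongrightarrow> m n"
proof (rule LIM_zero_cancel, rule Lim_null_comparison)
  show "\<forall>\<^sub>F K in sequentially.
     norm ((\<Sum>j\<le>Suc K. (real j / real (Suc K)) ^ n * bernstein_weight m (Suc K) j) - m n)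
       \<le> 2 * (real n)\<^sup>2 / real (Suc K)"
    using eventually_ge_at_top[of "2 * n"]
  proof eventually_elim
    case (elim K)
    let ?K = "Suc K" and ?b = "bernstein_weight m (Suc K)"
    have "n \<le> ?K" using elim by simp
    then have "(\<Sum>j\<le>?K. (real j / real ?K) ^ n * ?b j) - m n
        = (\<Sum>j\<le>?K. ((real j / real ?K) ^ n - real (j choose n) / real (?K choose n)) * ?b j)"
      using bernstein_weight_factorial_moment[of n ?K m]
      by (simp add: left_diff_distrib right_diff_distrib sum_subtractf mult.commute[of _ "?b _"] del: sum.atMost_Suc)
    also have "norm \<dots> \<le> (\<Sum>j\<le>?K. 2 * (real n)\<^sup>2 / real ?K * ?b j)"
    proof (rule sum_norm_le)
      fix j assume "j \<in> {..?K}"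
      then have "\<bar>(real j / real ?K) ^ n - real (j choose n) / real (?K choose n)\<bar> \<le> 2 * (real n)\<^sup>2 / real ?K"
        using elim by (intro power_factorial_ratio_close) auto
      then show "norm (((real j / real ?K) ^ n - real (j choose n) / real (?K choose n)) * ?b j)
          \<le> 2 * (real n)\<^sup>2 / real ?K * ?b j"
        unfolding real_norm_def abs_mult abs_of_nonneg[OF bernstein_weight_nonneg[OF m]]
        by (rule mult_right_mono[OF _ bernstein_weight_nonneg[OF m]])
    qed
    also have "\<dots> = 2 * (real n)\<^sup>2 / real ?K"
      using bernstein_weight_factorial_moment[of 0 ?K m] m0
      unfolding sum_distrib_left[symmetric] by (simp del: sum.atMost_Suc)
    finally show ?case .
  qed
  show "(\<lambda>K. 2 * (real n)\<^sup>2 / real (Suc K)) \<longlonglongrightarrow> 0"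
    by (rule LIMSEQ_Suc[OF lim_const_over_n])
qed

text \<open>The Bernstein measures live on \<open>[0,1]\<close>, so they are tight, and by Helly's theorem a
  subsequence converges weakly. The random variable \<open>X\<close> is the retraction of the line to
  \<open>[0,1]\<close>: its powers are bounded and continuous, so their means converge, and its values lie in
  \<open>[0,1]\<close> without exception.\<close>

theorem hausdorff_moment_problem:
  assumes m: "completely_monotone m" and m0: "m 0 = 1"
  obtains M :: "real measure" and X where "prob_space M" "X \<in> borel_measurable M"
    "\<And>\<omega>. X \<omega> \<in> {0..1}" "\<And>n. m n = (\<integral>\<omega>. X \<omega> ^ n \<partial>M)"
proof -
  let ?w = "\<lambda>K j. if j \<le> Suc K then bernstein_weight m (Suc K) j else 0"
  define P where "P K = embed_pmf (?w K)" for K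
  define \<nu> where "\<nu> K = distr (measure_pmf (P K)) borel (\<lambda>j. real j / real (Suc K))" for K
  have pmf_P: "pmf (P K) j = ?w K j" for K j
    unfolding P_def
  proof (rule pmf_embed_pmf)
    show "0 \<le> ?w K j" for j using bernstein_weight_nonneg[OF m] by auto
    have "(\<integral>\<^sup>+j. ennreal (?w K j) \<partial>count_space UNIV) = (\<Sum>j\<le>Suc K. ennreal (?w K j))"
      by (rule nn_integral_count_space') auto
    also have "\<dots> = ennreal (\<Sum>j\<le>Suc K. bernstein_weight m (Suc K) j)"
      by (subst sum_ennreal[symmetric]) (auto intro: bernstein_weight_nonneg[OF m] simp del: sum.atMost_Suc)
    also have "\<dots> = 1"
      using bernstein_weight_factorial_moment[of 0 "Suc K" m] m0 by (simp del: sum.atMost_Suc)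
    finally show "(\<integral>\<^sup>+j. ennreal (?w K j) \<partial>count_space UNIV) = 1" .
  qed
  have set_P: "set_pmf (P K) \<subseteq> {..Suc K}" for K
    by (auto simp: set_pmf_eq pmf_P split: if_splits)
  have real_dist: "real_distribution (\<nu> K)" for K
    unfolding \<nu>_def by (intro prob_space.real_distribution_distr measure_pmf.prob_space_axioms) simp
  have support: "measure (\<nu> K) {-1<..1} = 1" for K
  proof -
    have "measure (\<nu> K) {-1<..1} = measure (measure_pmf (P K)) {j. real j / real (Suc K) \<in> {-1<..1}}"
      by (simp add: \<nu>_def measure_distr vimage_def)
    also have "\<dots> = 1"
    proof -
      have "AE j in measure_pmf (P K). real j / real (Suc K) \<in> {-1<..1}"
        unfolding AE_measure_pmf_iff
      proof
        fix j assume "j \<in> set_pmf (P K)"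
        then have "real j \<le> real (Suc K)" using set_P[of K] by (auto simp del: of_nat_Suc)
        then have "real j / real (Suc K) \<le> 1" by simp
        moreover have "- 1 < real j / real (Suc K)"
          by (rule less_le_trans[of _ 0]) auto
        ultimately show "real j / real (Suc K) \<in> {-1<..1}" by simp
      qed
      then show ?thesis by (subst measure_pmf.prob_eq_1) auto
    qed
    finally show ?thesis .
  qed
  have "tight \<nu>"
    unfolding tight_def
  proof (intro conjI allI impI real_dist)
    fix \<epsilon> :: real assume "\<epsilon> > 0"
    then show "\<exists>a b. a < b \<and> (\<forall>n. 1 - \<epsilon> < measure (\<nu> n) {a<..b})"
      by (intro exI[of _ "-1"] exI[of _ 1]) (simp add: support)
  qed
  then obtain r M where r: "strict_mono r" and M: "real_distribution M" and conv: "weak_conv_m (\<nu> \<circ> id \<circ> r) M"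
    using tight_imp_convergent_subsubsequence[of \<nu> id] by (auto simp: strict_mono_id)
  interpret M: real_distribution M by fact
  define X where "X x = max 0 (min 1 x)" for x :: real
  have X01: "X x \<in> {0..1}" for x by (auto simp: X_def)
  have Xcont: "isCont (\<lambda>x. X x ^ n) x" for x n
    unfolding X_def by (intro continuous_intros)
  have Xmeas: "X \<in> borel_measurable M" unfolding X_def by simp
  show thesis
  proof (rule that[OF M.prob_space_axioms Xmeas X01])
    fix n
    have "(\<lambda>k. \<integral>x. X x ^ n \<partial>(\<nu> \<circ> id \<circ> r) k) \<longlonglongrightarrow> (\<integral>x. X x ^ n \<partial>M)"
    proof (rule weak_conv_imp_integral_bdd_continuous_conv)
      show "norm (X x ^ n) \<le> 1" for x
        using X01[of x] by (simp add: power_le_one)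
    qed (use Xcont real_dist M conv in \<open>auto simp: o_def\<close>)
    moreover have "(\<integral>x. X x ^ n \<partial>\<nu> K) = (\<Sum>j\<le>Suc K. (real j / real (Suc K)) ^ n * bernstein_weight m (Suc K) j)" for K
    proof -
      have "(\<integral>x. X x ^ n \<partial>\<nu> K) = (\<integral>j. X (real j / real (Suc K)) ^ n \<partial>measure_pmf (P K))"
        unfolding \<nu>_def by (subst integral_distr) (auto simp: X_def)
      also have "\<dots> = (\<Sum>j\<le>Suc K. X (real j / real (Suc K)) ^ n * pmf (P K) j)"
        using set_P[of K] by (intro integral_measure_pmf_real) auto
      also have "\<dots> = (\<Sum>j\<le>Suc K. (real j / real (Suc K)) ^ n * bernstein_weight m (Suc K) j)"
      proof (intro sum.cong refl)
        fix j assume "j \<in> {..Suc K}"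
        then have "real j \<le> real (Suc K)" by (simp only: atMost_iff of_nat_le_iff)
        then have "real j / real (Suc K) \<le> 1" by simp
        then have "X (real j / real (Suc K)) = real j / real (Suc K)" by (simp add: X_def)
        then show "X (real j / real (Suc K)) ^ n * pmf (P K) j
            = (real j / real (Suc K)) ^ n * bernstein_weight m (Suc K) j"
          using \<open>j \<in> {..Suc K}\<close> by (simp add: pmf_P)
      qed
      finally show ?thesis .
    qed
    moreover have "(\<lambda>k. \<Sum>j\<le>Suc (r k). (real j / real (Suc (r k))) ^ n * bernstein_weight m (Suc (r k)) j) \<longlonglongrightarrow> m n"
      using LIMSEQ_subseq_LIMSEQ[OF bernstein_weight_moments_converge[OF m m0, of n] r] by (simp add: o_def del: sum.atMost_Suc)
    ultimately show "m n = (\<integral>\<omega>. X \<omega> ^ n \<partial>M)"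
      by (intro LIMSEQ_unique) (auto simp: o_def simp del: sum.atMost_Suc)
  qed
qed

section \<open>Continued fractions with chain sequence coefficients\<close>

definition chain_weight :: "(nat \<Rightarrow> real) \<Rightarrow> nat \<Rightarrow> real" where
  "chain_weight g k = (case k of 0 \<Rightarrow> 0 | Suc j \<Rightarrow> sqrt ((1 - g j) * g k))"

text \<open>The symmetric tridiagonal matrix \<open>T\<close> with off-diagonal entries \<open>chain_weight g (k + 1)\<close>
  in places \<open>(k, k + 1)\<close>, acting on all sequences. At \<open>k = 0\<close> the meaningless entry \<open>x (0 - 1)\<close>
  has the coefficient \<open>chain_weight g 0 = 0\<close>.\<close>

definition chain_op :: "(nat \<Rightarrow> real) \<Rightarrow> (nat \<Rightarrow> real) \<Rightarrow> nat \<Rightarrow> real" where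
  "chain_op g x k = chain_weight g k * x (k - 1) + chain_weight g (Suc k) * x (Suc k)"

text \<open>The operator \<open>1 - T\<^sup>2\<close>.\<close>

definition chain_defect :: "(nat \<Rightarrow> real) \<Rightarrow> (nat \<Rightarrow> real) \<Rightarrow> nat \<Rightarrow> real" where
  "chain_defect g x k = x k - chain_op g (chain_op g x) k"

definition basis0 :: "nat \<Rightarrow> real" where
  "basis0 k = of_bool (k = 0)"

definition chain_moment :: "(nat \<Rightarrow> real) \<Rightarrow> nat \<Rightarrow> real" where
  "chain_moment g n = (chain_op g ^^ (2 * n)) basis0 0"

text \<open>If \<open>g N = 0\<close>, then \<open>T\<close> does not couple the coordinates below \<open>N\<close> to the others. This
  degenerate form then makes \<open>T\<close> symmetric on the space of all sequences, whatever their
  supports.\<close>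

definition inner_upto :: "nat \<Rightarrow> (nat \<Rightarrow> real) \<Rightarrow> (nat \<Rightarrow> real) \<Rightarrow> real" where
  "inner_upto N x y = (\<Sum>k<N. x k * y k)"

lemma chain_weight_0 [simp]: "chain_weight g 0 = 0"
  by (simp add: chain_weight_def)

lemma chain_weight_Suc: "chain_weight g (Suc k) = sqrt ((1 - g k) * g (Suc k))"
  by (simp add: chain_weight_def)

lemma sum_shift_lessThan:
  fixes f :: "nat \<Rightarrow> real"
  shows "(\<Sum>k<N. f k) = (\<Sum>k<N. f (Suc k)) + f 0 - f N"
  using sum_lessThan_telescope'[of f N] by (simp add: sum_subtractf)

lemma chain_op_symmetric:
  assumes "g N = 0"
  shows "inner_upto N (chain_op g x) y = inner_upto N x (chain_op g y)"
proof -
  have w: "chain_weight g N = 0"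
    using assms by (cases N) (simp_all add: chain_weight_Suc)
  have shift: "(\<Sum>k<N. chain_weight g k * u (k - 1) * v k) = (\<Sum>k<N. chain_weight g (Suc k) * u k * v (Suc k))"
    for u v :: "nat \<Rightarrow> real"
    using sum_shift_lessThan[of "\<lambda>k. chain_weight g k * u (k - 1) * v k" N] w by simp
  show ?thesis
    using shift[of x y] shift[of y x]
    by (simp add: inner_upto_def chain_op_def algebra_simps sum.distrib)
qed

text \<open>Each row of \<open>T\<close> has the entries \<open>sqrt ((1 - g\<^sub>k\<^sub>-\<^sub>1) g\<^sub>k)\<close> and \<open>sqrt ((1 - g\<^sub>k) g\<^sub>k\<^sub>+\<^sub>1)\<close>. The
  Cauchy--Schwarz inequality with \<open>g\<^sub>k + (1 - g\<^sub>k) = 1\<close> bounds the square of the row sum by \<open>(1 -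
  g\<^sub>k\<^sub>-\<^sub>1) x\<^sub>k\<^sub>-\<^sub>1\<^sup>2 + g\<^sub>k\<^sub>+\<^sub>1 x\<^sub>k\<^sub>+\<^sub>1\<^sup>2\<close>. Summed over \<open>k\<close>, each \<open>x\<^sub>j\<^sup>2\<close> receives the total weight \<open>(1 - g\<^sub>j) +
  g\<^sub>j = 1\<close>.\<close>

lemma chain_op_contractive:
  assumes g: "\<And>k. g k \<in> {0..1}" and gN: "g N = 0"
  shows "inner_upto N (chain_op g x) (chain_op g x) \<le> inner_upto N x x"
proof -
  define l where "l k = (if k = 0 then 0 else (1 - g (k - 1)) * (x (k - 1))\<^sup>2)" for k
  define r where "r k = g k * (x k)\<^sup>2" for k
  have g0: "0 \<le> g k" "0 \<le> 1 - g k" for k using g[of k] by auto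
  have pointwise: "(chain_op g x k)\<^sup>2 \<le> l k + r (Suc k)" for k
  proof (cases k)
    case 0
    have "(1 - g 0) * (g (Suc 0) * (x (Suc 0))\<^sup>2) \<le> 1 * (g (Suc 0) * (x (Suc 0))\<^sup>2)"
      by (intro mult_right_mono mult_nonneg_nonneg g0 zero_le_power2) (use g0(1)[of 0] in simp)
    then show ?thesis
      using 0 g0(1)[of "Suc 0"] g0(2)[of 0]
      by (simp add: chain_op_def l_def r_def chain_weight_Suc power_mult_distrib mult.assoc)
  next
    case (Suc j)
    define A where "A = sqrt (1 - g j) * x j"
    define B where "B = sqrt (g (Suc k)) * x (Suc k)"
    \<comment> \<open>the row sum is the scalar product of the unit vector \<open>(p, s)\<close> with \<open>(A, B)\<close>\<close>
    define p where "p = sqrt (g k)"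
    define s where "s = sqrt (1 - g k)"
    have ps: "p\<^sup>2 + s\<^sup>2 = 1" using g0[of k] by (simp add: p_def s_def)
    have "chain_op g x k = p * A + s * B"
      using Suc by (simp add: chain_op_def chain_weight_Suc real_sqrt_mult A_def B_def p_def s_def)
    then have "(chain_op g x k)\<^sup>2 = (p\<^sup>2 + s\<^sup>2) * (A\<^sup>2 + B\<^sup>2) - (p * B - s * A)\<^sup>2"
      by (simp add: power2_eq_square algebra_simps)
    also have "\<dots> \<le> A\<^sup>2 + B\<^sup>2" by (simp add: ps)
    also have "\<dots> = l k + r (Suc k)"
      using Suc g0(2)[of j] g0(1)[of "Suc k"] by (simp add: A_def B_def l_def r_def power_mult_distrib)
    finally show ?thesis .
  qed
  have "inner_upto N (chain_op g x) (chain_op g x) = (\<Sum>k<N. (chain_op g x k)\<^sup>2)"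
    by (simp add: inner_upto_def power2_eq_square)
  also have "\<dots> \<le> (\<Sum>k<N. l k) + (\<Sum>k<N. r (Suc k))"
    by (subst sum.distrib[symmetric]) (intro sum_mono pointwise)
  also have "\<dots> \<le> (\<Sum>k<N. l (Suc k)) + (\<Sum>k<N. r k)"
  proof -
    have "l 0 = 0" "l N \<ge> 0" "r 0 \<ge> 0" "r N = 0"
      using gN g0 by (auto simp: l_def r_def)
    then show ?thesis
      using sum_shift_lessThan[of l N] sum_shift_lessThan[of r N] by linarith
  qed
  also have "\<dots> = inner_upto N x x"
    by (simp add: l_def r_def inner_upto_def sum.distrib[symmetric] algebra_simps power2_eq_square)
  finally show ?thesis .
qed

lemma chain_op_diff: "chain_op g (\<lambda>k. x k - y k) = (\<lambda>k. chain_op g x k - chain_op g y k)"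
  by (simp add: fun_eq_iff chain_op_def algebra_simps)

lemma chain_op_funpow_diff:
  "(chain_op g ^^ n) (\<lambda>k. x k - y k) = (\<lambda>k. (chain_op g ^^ n) x k - (chain_op g ^^ n) y k)"
  by (induction n) (simp_all add: chain_op_diff)

lemma chain_op_defect_commute: "chain_op g (chain_defect g x) = chain_defect g (chain_op g x)"
  unfolding chain_defect_def[abs_def] by (rule chain_op_diff)

lemma chain_op_defect_funpow_commute:
  "(chain_op g ^^ n) ((chain_defect g ^^ k) x) = (chain_defect g ^^ k) ((chain_op g ^^ n) x)"
proof -
  have *: "chain_op g ((chain_defect g ^^ k) x) = (chain_defect g ^^ k) (chain_op g x)" for x
    by (induction k) (simp_all add: chain_op_defect_commute)
  show ?thesis by (induction n) (simp_all add: *)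
qed

lemma chain_op_funpow_symmetric:
  assumes "g N = 0"
  shows "inner_upto N ((chain_op g ^^ n) x) y = inner_upto N x ((chain_op g ^^ n) y)"
proof (induction n arbitrary: y)
  case (Suc n)
  show ?case
    using Suc.IH[of "chain_op g y"] by (simp add: chain_op_symmetric[of g N, OF assms] funpow_swap1[of _ n y])
qed simp

lemma inner_upto_diff_right: "inner_upto N x (\<lambda>k. y k - z k) = inner_upto N x y - inner_upto N x z"
  by (simp add: inner_upto_def algebra_simps sum_subtractf)

lemma inner_upto_diff_left: "inner_upto N (\<lambda>k. y k - z k) x = inner_upto N y x - inner_upto N z x"
  by (simp add: inner_upto_def algebra_simps sum_subtractf)

lemma chain_defect_symmetric:
  assumes "g N = 0"
  shows "inner_upto N (chain_defect g x) y = inner_upto N x (chain_defect g y)"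
  by (simp add: chain_defect_def[abs_def] inner_upto_diff_left inner_upto_diff_right
      chain_op_symmetric[of g N, OF assms])

lemma inner_upto_self_nonneg: "0 \<le> inner_upto N x x"
  by (simp add: inner_upto_def sum_nonneg)

text \<open>The operator \<open>1 - T\<^sup>2\<close> is symmetric and, \<open>T\<close> being a contraction, nonnegative. Moving
  half of the factors to the left argument leaves the power \<open>0\<close> or \<open>1\<close>.\<close>

lemma chain_defect_funpow_nonneg:
  assumes g: "\<And>k. g k \<in> {0..1}" and gN: "g N = 0"
  shows "0 \<le> inner_upto N x ((chain_defect g ^^ k) x)"
proof (induction k arbitrary: x rule: less_induct)
  case (less k)
  consider "k = 0" | "k = 1" | j where "k = Suc (Suc j)"
    by (cases k rule: nat.exhaust; cases "k - 1") auto
  then show ?case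
  proof cases
    case 1
    then show ?thesis by (simp add: inner_upto_self_nonneg)
  next
    case 2
    have "inner_upto N x (chain_defect g x)
        = inner_upto N x x - inner_upto N (chain_op g x) (chain_op g x)"
      by (simp add: chain_defect_def[abs_def] inner_upto_diff_right chain_op_symmetric[of g N, OF gN])
    then show ?thesis using 2 chain_op_contractive[of g N x, OF g gN] by simp
  next
    case 3
    have "inner_upto N x ((chain_defect g ^^ k) x)
        = inner_upto N (chain_defect g x) ((chain_defect g ^^ j) (chain_defect g x))"
      by (simp add: 3 chain_defect_symmetric[of g N, OF gN] funpow_swap1)
    then show ?thesis using less.IH[of j] 3 by simp
  qed
qed

text \<open>The \<open>k\<close>-th difference of \<open>n \<mapsto> \<langle>e, T\<^sup>2\<^sup>n e\<rangle>\<close> is \<open>\<langle>e, T\<^sup>2\<^sup>n (1 - T\<^sup>2)\<^sup>k e\<rangle>\<close>; by symmetry and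
  commutation \<open>T\<^sup>n\<close> can be applied to both arguments.\<close>

lemma chain_moment_differences:
  fixes g :: "nat \<Rightarrow> real"
  assumes gN: "g N = 0" and N: "0 < N"
  shows "(decrement ^^ k) (chain_moment g) n
    = inner_upto N ((chain_op g ^^ n) basis0) ((chain_defect g ^^ k) ((chain_op g ^^ n) basis0))"
proof -
  have e: "inner_upto N basis0 y = y 0" for y
  proof -
    have "inner_upto N basis0 y = (\<Sum>k<N. if k = 0 then y k else 0)"
      by (auto simp: inner_upto_def basis0_def intro!: sum.cong)
    also have "\<dots> = y 0" using N by simp
    finally show ?thesis .
  qed
  have "(decrement ^^ k) (chain_moment g) n = (chain_op g ^^ (2 * n)) ((chain_defect g ^^ k) basis0) 0"
  proof (induction k arbitrary: n)
    case 0
    show ?case by (simp add: chain_moment_def)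
  next
    case (Suc k)
    define y where "y = (chain_defect g ^^ k) basis0"
    have "(chain_defect g ^^ Suc k) basis0 = (\<lambda>i. y i - chain_op g (chain_op g y) i)"
      unfolding funpow.simps(2) o_apply y_def[symmetric] by (rule ext) (rule chain_defect_def)
    then have "(chain_op g ^^ (2 * n)) ((chain_defect g ^^ Suc k) basis0) 0
        = (chain_op g ^^ (2 * n)) y 0 - (chain_op g ^^ (2 * Suc n)) y 0"
      by (simp add: chain_op_funpow_diff funpow_swap1)
    then show ?case by (simp only: decrement_funpow_Suc Suc.IH y_def)
  qed
  also have "\<dots> = inner_upto N basis0 ((chain_op g ^^ n) ((chain_op g ^^ n) ((chain_defect g ^^ k) basis0)))"
    by (simp add: e mult_2 funpow_add)
  also have "\<dots> = inner_upto N ((chain_op g ^^ n) basis0) ((chain_defect g ^^ k) ((chain_op g ^^ n) basis0))"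
    by (simp add: chain_op_funpow_symmetric[of g N, OF gN, where x=basis0] chain_op_defect_funpow_commute)
  finally show ?thesis .
qed

text \<open>In \<open>n\<close> steps the tridiagonal matrix only reaches coordinates up to \<open>k + n\<close>, so cutting
  \<open>g\<close> off beyond them makes no difference.\<close>

lemma chain_op_truncate:
  fixes g :: "nat \<Rightarrow> real"
  assumes "k + n < N"
  shows "(chain_op (\<lambda>k. if k < N then g k else 0) ^^ n) x k = (chain_op g ^^ n) x k"
  using assms
proof (induction n arbitrary: k)
  case (Suc n)
  have "chain_weight (\<lambda>k. if k < N then g k else 0) i = chain_weight g i" if "i < N" for i
    using that by (cases i) (auto simp: chain_weight_Suc)
  then show ?case
    unfolding funpow.simps(2) o_apply chain_op_def[of _ "(chain_op _ ^^ n) x" k]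
    using Suc.prems by (simp add: Suc.IH)
qed simp

text \<open>A given difference involves finitely many moments. Cutting \<open>g\<close> off far enough does not
  change them and makes the finite-dimensional argument applicable.\<close>

lemma completely_monotone_chain_moment:
  assumes g: "\<And>k. g k \<in> {0..1}"
  shows "completely_monotone (chain_moment g)"
  unfolding completely_monotone_def
proof (intro allI)
  fix k n
  define N where "N = Suc (2 * (n + k))"
  define h where "h k = (if k < N then g k else 0)" for k
  have "(decrement ^^ k) (chain_moment g) n = (decrement ^^ k) (chain_moment h) n"
    by (intro decrement_cong)
      (simp add: chain_moment_def h_def[abs_def] chain_op_truncate N_def)
  also have "\<dots> \<ge> 0"
  proof -
    have "h N = 0" "0 < N" "\<And>k. h k \<in> {0..1}" using g by (auto simp: h_def N_def)
    note h = this
    show ?thesis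
      unfolding chain_moment_differences[of h N, OF h(1,2)] by (rule chain_defect_funpow_nonneg[of h N, OF h(3,1)])
  qed
  finally show "0 \<le> (decrement ^^ k) (chain_moment g) n" .
qed

lemma chain_moment_0: "chain_moment g 0 = 1"
  by (simp add: chain_moment_def basis0_def)

text \<open>With \<open>R\<^sub>k = A\<^sub>k/A\<^sub>0\<close> the recurrence says that the coefficients of \<open>R\<^sub>k\<^sub>+\<^sub>1\<close>, scaled by the
  product of the first \<open>k\<close> weights, satisfy the same recursion as the coordinates of the vectors
  \<open>T\<^sup>i e\<close>: the coefficient of index \<open>n\<close> belongs to coordinate \<open>k\<close> after \<open>2n + k\<close> steps. This is
  the path expansion of a continued fraction of Stieltjes type, proved by induction on \<open>2n + k\<close>.\<close>

lemma chain_fraction_moments: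
  fixes A :: "nat \<Rightarrow> real fps"
  assumes g: "\<And>k. g k \<in> {0..1}"
    and A0: "\<And>k. fps_nth (A k) 0 = 1"
    and rec: "\<And>k. A k = A (Suc k) - fps_const ((1 - g k) * g (Suc k)) * fps_X * A (Suc (Suc k))"
  shows "A 1 = A 0 * Abs_fps (chain_moment g)"
proof -
  define R where "R k = A k * inverse (A 0)" for k
  define W where "W k = (\<Prod>i<k. chain_weight g (Suc i))" for k
  define d where "d k = (1 - g k) * g (Suc k)" for k
  have inv: "A 0 * inverse (A 0) = 1"
    using A0[of 0] by (intro inverse_mult_eq_1') simp
  then have R0: "R 0 = 1" by (simp add: R_def)
  have wd: "chain_weight g (Suc k) * chain_weight g (Suc k) = d k" for k
    using g[of k] g[of "Suc k"] by (simp add: chain_weight_Suc d_def)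
  have R_Suc: "R (Suc k) = R k + fps_const (d k) * (fps_X * R (Suc (Suc k)))" for k
    using arg_cong[OF rec[of k], of "\<lambda>F. F * inverse (A 0)"] by (simp add: R_def d_def algebra_simps)
  have Rn: "fps_nth (R (Suc k)) n = fps_nth (R k) n + d k * fps_nth (fps_X * R (Suc (Suc k))) n" for k n
    by (subst R_Suc) (simp only: fps_add_nth fps_mult_left_const_nth)
  have coeff: "(chain_op g ^^ (2 * n + k)) basis0 k = W k * fps_nth (R (Suc k)) n" for n k
  proof (induction "2 * n + k" arbitrary: n k rule: less_induct)
    case less
    let ?u = "\<lambda>i. (chain_op g ^^ i) basis0"
    show ?case
    proof (cases "2 * n + k")
      case 0
      then show ?thesis by (simp add: W_def R_def A0 basis0_def)
    next
      case (Suc p)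
      \<comment> \<open>the last step comes from coordinate \<open>k - 1\<close> or from coordinate \<open>k + 1\<close>; coordinate \<open>0\<close> has no predecessor, matching \<open>R\<^sub>0 = 1\<close>\<close>
      have down: "chain_weight g k * ?u p (k - 1) = W k * fps_nth (R k) n"
      proof (cases k)
        case 0
        then show ?thesis using Suc R0 by (cases n) auto
      next
        case (Suc j)
        then have "p = 2 * n + j" using \<open>2 * n + k = Suc p\<close> by simp
        then show ?thesis using less[of n j] Suc by (simp add: W_def)
      qed
      have up: "chain_weight g (Suc k) * ?u p (Suc k) = W k * (d k * fps_nth (fps_X * R (Suc (Suc k))) n)"
      proof (cases n)
        case 0
        have "?u i j = 0" if "i < j" for i j
          using that
        proof (induction i arbitrary: j)
          case (Suc i)
          then show ?case
            unfolding funpow.simps(2) o_apply chain_op_def[of _ "?u i" j] by simp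
        qed (simp add: basis0_def)
        then show ?thesis using 0 Suc by simp
      next
        case (Suc n')
        then have "p = 2 * n' + Suc k" using \<open>2 * n + k = Suc p\<close> by simp
        then have "?u p (Suc k) = W (Suc k) * fps_nth (R (Suc (Suc k))) n'"
          using less[of n' "Suc k"] Suc by simp
        then have "chain_weight g (Suc k) * ?u p (Suc k)
            = W k * (chain_weight g (Suc k) * chain_weight g (Suc k)) * fps_nth (R (Suc (Suc k))) n'"
          by (simp add: W_def)
        then show ?thesis using Suc by (simp only: wd) simp
      qed
      have "?u (Suc p) k = W k * fps_nth (R (Suc k)) n"
        unfolding funpow.simps(2) o_apply chain_op_def[of _ "?u p" k] down up Rn by (simp add: distrib_left)
      then show ?thesis using Suc by simp
    qed
  qed
  have "R 1 = Abs_fps (chain_moment g)"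
    using coeff[of _ 0] by (simp add: fps_eq_iff chain_moment_def W_def)
  moreover have "A 1 = A 0 * R 1"
    using inv by (simp add: R_def mult_ac)
  ultimately show ?thesis by simp
qed

section \<open>Stieltjes integrals against distribution functions\<close>

text \<open>The distribution function of \<open>X\<close>, modified at \<open>0\<close>: a Stieltjes integral over \<open>[0,1]\<close>
  sees an atom at \<open>0\<close> only as a jump of \<open>\<mu>\<close> immediately after \<open>0\<close>, so \<open>\<mu> 0\<close> has to be \<open>0\<close>.\<close>

definition jump_distribution :: "'a measure \<Rightarrow> ('a \<Rightarrow> real) \<Rightarrow> real \<Rightarrow> real" where
  "jump_distribution M X t = (if t \<le> 0 then 0 else measure M {\<omega> \<in> space M. X \<omega> \<le> t})"

lemma (in prob_space) jump_distribution_properties: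
  assumes [measurable]: "X \<in> borel_measurable M" and X: "\<And>\<omega>. \<omega> \<in> space M \<Longrightarrow> X \<omega> \<in> {0..1}"
  shows "jump_distribution M X \<in> {0..1} \<rightarrow> {0..1}" "mono_on {0..1} (jump_distribution M X)"
    "jump_distribution M X 1 - jump_distribution M X 0 = 1"
proof -
  show "jump_distribution M X \<in> {0..1} \<rightarrow> {0..1}" by (auto simp: jump_distribution_def)
  show "mono_on {0..1} (jump_distribution M X)"
    by (intro mono_onI) (auto simp: jump_distribution_def intro!: finite_measure_mono)
  have "{\<omega> \<in> space M. X \<omega> \<le> 1} = space M" using X by auto
  then show "jump_distribution M X 1 - jump_distribution M X 0 = 1"
    by (simp add: jump_distribution_def prob_space)
qed

lemma has_stieltjes_integral_unique:
  assumes "has_stieltjes_integral f \<mu> a b I" "has_stieltjes_integral f \<mu> a b J"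
  shows "I = J"
proof (rule ccontr)
  assume "I \<noteq> J"
  define e where "e = norm (I - J) / 2"
  have e: "e > 0" using \<open>I \<noteq> J\<close> by (simp add: e_def)
  define S where "S p = (\<Sum>(x, K)\<in>p. (\<mu> (Sup K) - \<mu> (Inf K)) *\<^sub>R f x)" for p
  obtain d1 where d1: "d1 > 0"
    "\<forall>p. p tagged_division_of {a..b} \<and> (\<lambda>x. ball x d1) fine p \<longrightarrow> norm (S p - I) < e"
    using assms(1)[unfolded has_stieltjes_integral_def, rule_format, OF e] unfolding S_def by (elim exE conjE)
  obtain d2 where d2: "d2 > 0"
    "\<forall>p. p tagged_division_of {a..b} \<and> (\<lambda>x. ball x d2) fine p \<longrightarrow> norm (S p - J) < e"
    using assms(2)[unfolded has_stieltjes_integral_def, rule_format, OF e] unfolding S_def by (elim exE conjE)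
  obtain p where p: "p tagged_division_of {a..b}" "(\<lambda>x. ball x (min d1 d2)) fine p"
    using fine_division_exists_real[of "\<lambda>x. ball x (min d1 d2)" a b] d1(1) d2(1)
    by (auto simp: gauge_def)
  have "(\<lambda>x. ball x d1) fine p" "(\<lambda>x. ball x d2) fine p"
    using p(2) by (auto simp: fine_def subset_eq)
  then have "norm (S p - I) < e" "norm (S p - J) < e"
    using d1(2) d2(2) p(1) by simp_all
  then have "norm (I - J) < e + e"
    using norm_triangle_ineq4[of "S p - J" "S p - I"] by simp
  then show False by (simp add: e_def)
qed

text \<open>For each \<open>\<omega>\<close> the increments of the step function \<open>L\<close> over the intervals of a tagged
  division add up to \<open>1\<close>, and only intervals containing \<open>X \<omega>\<close> contribute. A Stieltjes sum is
  thus the mean of a weighted average of values \<open>f x\<close> with \<open>x\<close> close to \<open>X \<omega>\<close>, and uniform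
  continuity of \<open>f\<close> compares it with the mean of \<open>f (X \<omega>)\<close>.\<close>

lemma (in prob_space) has_stieltjes_integral_jump_distribution:
  fixes f :: "real \<Rightarrow> complex"
  assumes [measurable]: "X \<in> borel_measurable M" and X: "\<And>\<omega>. \<omega> \<in> space M \<Longrightarrow> X \<omega> \<in> {0..1}"
    and f: "continuous_on {0..1} f"
  shows "has_stieltjes_integral f (jump_distribution M X) 0 1 (\<integral>\<omega>. f (X \<omega>) \<partial>M)"
  unfolding has_stieltjes_integral_def
proof (intro allI impI)
  fix e :: real assume "e > 0"
  let ?\<mu> = "jump_distribution M X"
  have "uniformly_continuous_on {0..1} f"
    by (intro compact_uniformly_continuous f) simp
  then obtain d where d: "d > 0"
    and close: "\<And>s t. s \<in> {0..1} \<Longrightarrow> t \<in> {0..1} \<Longrightarrow> dist t s < d \<Longrightarrow> dist (f t) (f s) < e / 2"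
    using \<open>e > 0\<close> unfolding uniformly_continuous_on_def by (metis half_gt_zero)
  define L where "L t \<omega> = (if 0 < t \<and> X \<omega> \<le> t then 1 else 0 :: real)" for t \<omega>
  have [measurable]: "L t \<in> borel_measurable M" for t
    unfolding L_def[abs_def] by measurable
  have L_int: "integrable M (L t)" for t
    by (rule integrable_const_bound[of _ 1]) (auto simp: L_def)
  have L_integral: "(\<integral>\<omega>. L t \<omega> \<partial>M) = ?\<mu> t" for t
  proof (cases "t \<le> 0")
    case False
    have "(\<integral>\<omega>. L t \<omega> \<partial>M) = (\<integral>\<omega>. indicator {\<omega> \<in> space M. X \<omega> \<le> t} \<omega> \<partial>M)"
      using False by (intro Bochner_Integration.integral_cong) (auto simp: L_def indicator_def)
    then show ?thesis using False by (simp add: jump_distribution_def)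
  qed (simp add: L_def jump_distribution_def)
  have fX_meas [measurable]: "(\<lambda>\<omega>. f (X \<omega>)) \<in> borel_measurable M"
  proof -
    have "(\<lambda>t. indicator {0..1} t *\<^sub>R f t) \<in> borel_measurable borel"
      using f by (intro borel_measurable_continuous_on_indicator) auto
    then have "(\<lambda>\<omega>. indicator {0..1} (X \<omega>) *\<^sub>R f (X \<omega>)) \<in> borel_measurable M"
      by measurable
    then show ?thesis
      by (rule measurable_cong[THEN iffD1, rotated]) (use X in auto)
  qed
  obtain B where B: "\<And>t. t \<in> {0..1} \<Longrightarrow> norm (f t) \<le> B"
    using compact_imp_bounded[OF compact_continuous_image[OF f]] unfolding bounded_iff by blast
  have fX_int: "integrable M (\<lambda>\<omega>. f (X \<omega>))"
    by (rule integrable_const_bound[of _ B]) (use B X in auto)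
  show "\<exists>d>0. \<forall>p. p tagged_division_of {0..1} \<and> (\<lambda>x. ball x d) fine p \<longrightarrow>
      norm ((\<Sum>(x, K)\<in>p. (?\<mu> (Sup K) - ?\<mu> (Inf K)) *\<^sub>R f x) - (\<integral>\<omega>. f (X \<omega>) \<partial>M)) < e"
  proof (intro exI[of _ d] conjI allI impI d)
    fix p :: "(real \<times> real set) set"
    assume "p tagged_division_of {0..1} \<and> (\<lambda>x. ball x d) fine p"
    then have p: "p tagged_division_of {0..1}" and fine: "(\<lambda>x. ball x d) fine p" by auto
    have fin: "finite p" using p by (rule tagged_division_of_finite)
    define w where "w K \<omega> = L (Sup K) \<omega> - L (Inf K) \<omega>" for K \<omega>
    have total: "(\<Sum>c\<in>p. w (snd c) \<omega>) = 1" if "\<omega> \<in> space M" for \<omega>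
    proof -
      have "(\<Sum>(x, K)\<in>p. L (Sup K) \<omega> - L (Inf K) \<omega>) = L 1 \<omega> - L 0 \<omega>"
        by (rule additive_tagged_division_1[OF _ p]) simp
      also have "\<dots> = 1" using X[OF that] by (simp add: L_def)
      finally show ?thesis by (simp add: case_prod_unfold w_def)
    qed
    have local: "0 \<le> w (snd c) \<omega> \<and> w (snd c) \<omega> * norm (f (fst c) - f (X \<omega>)) \<le> w (snd c) \<omega> * (e / 2)"
      if c: "c \<in> p" and \<omega>: "\<omega> \<in> space M" for c \<omega>
    proof -
      obtain x K where xK: "c = (x, K)" by fastforce
      obtain u v where K: "K = {u..v}"
        using tagged_division_ofD(4)[OF p, of x K] c xK by auto
      have x: "x \<in> K" "K \<subseteq> {0..1}"
        using tagged_division_ofD(2,3)[OF p, of x K] c xK by auto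
      have uv: "u \<le> v" using x(1) K by simp
      have SI: "Sup K = v" "Inf K = u" using uv by (simp_all add: K)
      have nonneg: "0 \<le> w K \<omega>" using uv by (auto simp: w_def SI L_def)
      have "w K \<omega> * norm (f x - f (X \<omega>)) \<le> w K \<omega> * (e / 2)"
      proof (cases "w K \<omega> = 0")
        case False
        then have "X \<omega> \<in> {u..v}" using uv X[OF \<omega>] x(2)
          by (auto simp: w_def SI L_def K split: if_splits)
        moreover have "K \<subseteq> ball x d" using fine c xK by (auto simp: fine_def)
        ultimately have "dist x (X \<omega>) < d" by (auto simp: K)
        moreover have "x \<in> {0..1}" using x by blast
        ultimately have "dist (f x) (f (X \<omega>)) < e / 2"
          using close[OF X[OF \<omega>], of x] by blast
        then have "norm (f x - f (X \<omega>)) \<le> e / 2" by (simp add: dist_norm)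
        then show ?thesis using nonneg by (rule mult_left_mono)
      qed simp
      with nonneg show ?thesis by (simp add: xK)
    qed
    have w_int: "integrable M (w K)" for K
      unfolding w_def[abs_def] by (intro Bochner_Integration.integrable_diff L_int)
    then have wf_int: "integrable M (\<lambda>\<omega>. w K \<omega> *\<^sub>R f x)" for x K
      by (intro integrable_scaleR_left) simp
    then have sum_int: "integrable M (\<lambda>\<omega>. \<Sum>c\<in>p. w (snd c) \<omega> *\<^sub>R f (fst c))"
      by (intro Bochner_Integration.integrable_sum)
    have diff_int: "integrable M (\<lambda>\<omega>. (\<Sum>c\<in>p. w (snd c) \<omega> *\<^sub>R f (fst c)) - f (X \<omega>))"
      by (rule Bochner_Integration.integrable_diff[OF sum_int fX_int])
    have "(\<integral>\<omega>. w K \<omega> \<partial>M) = ?\<mu> (Sup K) - ?\<mu> (Inf K)" for K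
      unfolding w_def by (simp add: L_int L_integral)
    then have "(\<Sum>(x, K)\<in>p. (?\<mu> (Sup K) - ?\<mu> (Inf K)) *\<^sub>R f x) = (\<Sum>c\<in>p. \<integral>\<omega>. w (snd c) \<omega> *\<^sub>R f (fst c) \<partial>M)"
      using w_int by (simp add: case_prod_unfold)
    also have "\<dots> = (\<integral>\<omega>. (\<Sum>c\<in>p. w (snd c) \<omega> *\<^sub>R f (fst c)) \<partial>M)"
      by (rule Bochner_Integration.integral_sum[symmetric]) (rule wf_int)
    finally have "(\<Sum>(x, K)\<in>p. (?\<mu> (Sup K) - ?\<mu> (Inf K)) *\<^sub>R f x) - (\<integral>\<omega>. f (X \<omega>) \<partial>M)
        = (\<integral>\<omega>. (\<Sum>c\<in>p. w (snd c) \<omega> *\<^sub>R f (fst c)) - f (X \<omega>) \<partial>M)"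
      by (simp only: Bochner_Integration.integral_diff[OF sum_int fX_int])
    then have "norm ((\<Sum>(x, K)\<in>p. (?\<mu> (Sup K) - ?\<mu> (Inf K)) *\<^sub>R f x) - (\<integral>\<omega>. f (X \<omega>) \<partial>M))
        \<le> (\<integral>\<omega>. norm ((\<Sum>c\<in>p. w (snd c) \<omega> *\<^sub>R f (fst c)) - f (X \<omega>)) \<partial>M)"
      by (simp only: integral_norm_bound)
    also have "\<dots> \<le> (\<integral>\<omega>. e / 2 \<partial>M)"
    proof (rule integral_mono[OF integrable_norm[OF diff_int] integrable_const])
      fix \<omega> assume \<omega>: "\<omega> \<in> space M"
      have "(\<Sum>c\<in>p. w (snd c) \<omega> *\<^sub>R f (fst c)) - f (X \<omega>)
          = (\<Sum>c\<in>p. w (snd c) \<omega> *\<^sub>R f (fst c)) - (\<Sum>c\<in>p. w (snd c) \<omega>) *\<^sub>R f (X \<omega>)"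
        by (simp only: total[OF \<omega>] scaleR_one)
      also have "\<dots> = (\<Sum>c\<in>p. w (snd c) \<omega> *\<^sub>R (f (fst c) - f (X \<omega>)))"
        by (simp only: scaleR_sum_left sum_subtractf scaleR_diff_right)
      finally have "norm ((\<Sum>c\<in>p. w (snd c) \<omega> *\<^sub>R f (fst c)) - f (X \<omega>))
          \<le> (\<Sum>c\<in>p. norm (w (snd c) \<omega> *\<^sub>R (f (fst c) - f (X \<omega>))))"
        by (simp only: norm_sum)
      also have "\<dots> \<le> (\<Sum>c\<in>p. w (snd c) \<omega> * (e / 2))"
        by (intro sum_mono) (use local[OF _ \<omega>] in simp)
      also have "\<dots> = e / 2"
        by (simp only: sum_distrib_right[symmetric] total[OF \<omega>] mult_1)
      finally show "norm ((\<Sum>c\<in>p. w (snd c) \<omega> *\<^sub>R f (fst c)) - f (X \<omega>)) \<le> e / 2" .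
    qed
    also have "\<dots> < e" using \<open>e > 0\<close> by (simp add: prob_space)
    finally show "norm ((\<Sum>(x, K)\<in>p. (?\<mu> (Sup K) - ?\<mu> (Inf K)) *\<^sub>R f x) - (\<integral>\<omega>. f (X \<omega>) \<partial>M)) < e" .
  qed
qed

lemma stieltjes_integral_eqI:
  assumes "has_stieltjes_integral f \<mu> a b I"
  shows "stieltjes_integral f \<mu> a b = I"
  unfolding stieltjes_integral_def
  using assms by (rule the_equality) (rule has_stieltjes_integral_unique[OF _ assms])

section \<open>The kernel z/(1 - tz)\<close>

lemma Re_kernel:
  "Re (z / (1 - of_real t * z)) = (Re z * (1 - t * Re z) - t * (Im z)\<^sup>2) / ((1 - t * Re z)\<^sup>2 + (t * Im z)\<^sup>2)"
  by (simp add: Re_divide power2_eq_square algebra_simps)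

lemma Im_kernel:
  "Im (z / (1 - of_real t * z)) = Im z / ((1 - t * Re z)\<^sup>2 + (t * Im z)\<^sup>2)"
  by (simp add: Im_divide power2_eq_square algebra_simps)

text \<open>Only the sign of a difference of real parts matters. The lemma exhibits it as the sign
  of a polynomial which makes sense also for \<open>t = 0\<close>, when the kernel degenerates to the
  identity.\<close>

lemma Re_kernel_difference:
  fixes z w :: complex and t :: real
  defines "p \<equiv> 1 - t * Re z" and "p' \<equiv> 1 - t * Re w"
  assumes "0 < p" "0 < p'"
  obtains C where "0 < C"
    "Re (w / (1 - of_real t * w)) - Re (z / (1 - of_real t * z))
      = C * (p * p' * (Re w - Re z) + t * (p' * (Im z)\<^sup>2 - p * (Im w)\<^sup>2))"
proof
  let ?D = "p\<^sup>2 + (t * Im z)\<^sup>2" and ?D' = "p'\<^sup>2 + (t * Im w)\<^sup>2"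
  have D: "0 < ?D" "0 < ?D'" using assms(3,4) by (auto intro!: add_pos_nonneg)
  then show "0 < 1 / (?D * ?D')" by simp
  have "(Re w * p' - t * (Im w)\<^sup>2) * ?D - (Re z * p - t * (Im z)\<^sup>2) * ?D'
      = p * p' * (Re w - Re z) + t * (p' * (Im z)\<^sup>2 - p * (Im w)\<^sup>2)"
    by (simp add: p_def p'_def power2_eq_square algebra_simps)
  then show "Re (w / (1 - of_real t * w)) - Re (z / (1 - of_real t * z))
      = 1 / (?D * ?D') * (p * p' * (Re w - Re z) + t * (p' * (Im z)\<^sup>2 - p * (Im w)\<^sup>2))"
    using D by (simp only: Re_kernel p_def[symmetric] p'_def[symmetric] diff_frac_eq[OF D(2)[THEN less_imp_neq, symmetric] D(1)[THEN less_imp_neq, symmetric]])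
      (simp add: mult.commute)
qed

lemma Re_kernel_mono:
  fixes z w :: complex and t :: real
  assumes "0 < 1 - t * Re z" "0 < 1 - t * Re w"
    and "0 \<le> (1 - t * Re z) * (1 - t * Re w) * (Re w - Re z) + t * ((1 - t * Re w) * (Im z)\<^sup>2 - (1 - t * Re z) * (Im w)\<^sup>2)"
  shows "Re (z / (1 - of_real t * z)) \<le> Re (w / (1 - of_real t * w))"
  by (rule Re_kernel_difference[of t z w, OF assms(1,2)]) (use assms(3) in \<open>smt (verit) mult_nonneg_nonneg\<close>)

text \<open>The polynomial of \<open>Re_kernel_difference\<close>: for \<open>z\<close> and \<open>w\<close> to the left of the pole its
  sign is that of \<open>Re (w/(1 - tw)) - Re (z/(1 - tz))\<close>.\<close>

definition kernel_gap :: "real \<Rightarrow> complex \<Rightarrow> complex \<Rightarrow> real" where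
  "kernel_gap t z w = (1 - t * Re z) * (1 - t * Re w) * (Re w - Re z)
     + t * ((1 - t * Re w) * (Im z)\<^sup>2 - (1 - t * Re z) * (Im w)\<^sup>2)"

text \<open>On a circle about \<open>0\<close> the real part of the kernel is an increasing function of \<open>Re z\<close>,
  as long as the circle does not reach the pole \<open>1/t\<close>.\<close>

lemma kernel_gap_same_norm:
  assumes "norm z = norm w"
  shows "kernel_gap t z w = (Re w - Re z) * (1 - (t * norm w)\<^sup>2)"
proof -
  have "(Im z)\<^sup>2 = (norm w)\<^sup>2 - (Re z)\<^sup>2" "(Im w)\<^sup>2 = (norm w)\<^sup>2 - (Re w)\<^sup>2"
    using cmod_power2[of z] cmod_power2[of w] assms by simp_all
  then show ?thesis
    by (simp only: kernel_gap_def) (simp add: power2_eq_square algebra_simps)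
qed

section \<open>Transforms of probability measures in a cut plane\<close>

lemma cut_plane_eq: "cut_plane r = - {z. Im z = 0 \<and> r \<le> Re z}"
  by (auto simp: cut_plane_def image_iff complex_eq_iff)

lemma open_cut_plane: "open (cut_plane r)"
  unfolding cut_plane_eq
  by (intro open_Compl closed_Collect_conj closed_Collect_eq closed_Collect_le continuous_intros)

lemma (in prob_space) integral_positive:
  fixes f :: "'a \<Rightarrow> real"
  assumes "integrable M f" "\<And>\<omega>. \<omega> \<in> space M \<Longrightarrow> 0 < f \<omega>"
  shows "0 < (\<integral>\<omega>. f \<omega> \<partial>M)"
proof -
  have "(\<integral>\<omega>. 0 \<partial>M) < (\<integral>\<omega>. f \<omega> \<partial>M)"
    by (rule integral_less_AE_space) (use assms in \<open>auto simp: emeasure_space_1\<close>)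
  then show ?thesis by simp
qed

definition stieltjes_transform :: "'a measure \<Rightarrow> ('a \<Rightarrow> real) \<Rightarrow> complex \<Rightarrow> complex" where
  "stieltjes_transform M X z = (\<integral>\<omega>. z / (1 - of_real (X \<omega>) * z) \<partial>M)"

text \<open>The kernel \<open>z/(1 - X \<omega> z)\<close> has its pole at \<open>1/X \<omega>\<close>, at or to the right of \<open>\<rho>\<close>, and at
  infinity if \<open>X \<omega> = 0\<close>.\<close>

locale poles_beyond = prob_space M for M :: "'a measure" +
  fixes X :: "'a \<Rightarrow> real" and \<rho> :: real
  assumes X_measurable [measurable]: "X \<in> borel_measurable M"
    and \<rho>_pos: "0 < \<rho>"
    and X_range: "\<And>\<omega>. \<omega> \<in> space M \<Longrightarrow> X \<omega> \<in> {0..1/\<rho>}"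
begin

abbreviation F :: "complex \<Rightarrow> complex" where "F \<equiv> stieltjes_transform M X"

lemma denominator_nonzero:
  assumes "z \<in> cut_plane \<rho>" "t \<in> {0..1/\<rho>}"
  shows "1 - of_real t * z \<noteq> 0"
proof
  assume "1 - of_real t * z = 0"
  then have tz: "of_real t * z = 1" by simp
  then have t: "t > 0" using assms(2) by (cases "t = 0") auto
  then have z: "z = of_real (1 / t)" using tz by (simp add: field_simps)
  have "\<rho> \<le> 1 / t" using assms(2) t \<rho>_pos by (simp add: field_simps)
  then have "z \<in> of_real ` {\<rho>..}" unfolding z by (intro imageI) simp
  then show False using assms(1) by (simp add: cut_plane_def)
qed

text \<open>By compactness in \<open>z\<close> and in the location \<open>t\<close> of the reciprocal pole; it dominates all
  the integrands that follow.\<close>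

lemma denominator_bound:
  assumes "compact K" "K \<subseteq> cut_plane \<rho>"
  obtains B where "B > 0" "\<And>z t. z \<in> K \<Longrightarrow> t \<in> {0..1/\<rho>} \<Longrightarrow> norm (1 / (1 - of_real t * z)) \<le> B"
proof -
  let ?f = "\<lambda>(z, t). 1 / (1 - of_real t * z)"
  have "continuous_on (K \<times> {0..1/\<rho>}) ?f"
    unfolding case_prod_beta
    using assms denominator_nonzero by (intro continuous_intros) auto
  then have "bounded (?f ` (K \<times> {0..1/\<rho>}))"
    using assms(1) by (intro compact_imp_bounded compact_continuous_image) (auto intro: compact_Times)
  then obtain B where "B > 0" "\<And>x. x \<in> ?f ` (K \<times> {0..1/\<rho>}) \<Longrightarrow> norm x \<le> B"
    unfolding bounded_pos by blast
  then have "norm (?f (z, t)) \<le> B" if "z \<in> K" "t \<in> {0..1/\<rho>}" for z t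
    using that by blast
  with \<open>B > 0\<close> show thesis using that[of B] by simp
qed

text \<open>For \<open>z \<noteq> w\<close> this is \<open>(F z - F w)/(z - w)\<close>, and for \<open>z = w\<close> it is the derivative of \<open>F\<close>.\<close>

definition divided_difference :: "complex \<Rightarrow> complex \<Rightarrow> complex" where
  "divided_difference z w = (\<integral>\<omega>. 1 / ((1 - of_real (X \<omega>) * z) * (1 - of_real (X \<omega>) * w)) \<partial>M)"

lemma integrable_kernel:
  assumes "z \<in> cut_plane \<rho>"
  shows "integrable M (\<lambda>\<omega>. z / (1 - of_real (X \<omega>) * z))"
proof -
  obtain B where "\<And>t. t \<in> {0..1/\<rho>} \<Longrightarrow> norm (1 / (1 - of_real t * z)) \<le> B"
    using denominator_bound[of "{z}"] assms by (metis compact_sing empty_subsetI insert_subset singletonI)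
  then have B: "norm (1 / (1 - of_real (X \<omega>) * z)) \<le> B" if "\<omega> \<in> space M" for \<omega>
    using X_range that by blast
  have "norm (z / (1 - of_real (X \<omega>) * z)) \<le> norm z * B" if "\<omega> \<in> space M" for \<omega>
    using mult_left_mono[OF B[OF that], of "norm z"] by (simp add: norm_divide)
  then show ?thesis by (intro integrable_const_bound[of _ "norm z * B"]) auto
qed

lemma integrable_divided_difference:
  assumes "z \<in> cut_plane \<rho>" "w \<in> cut_plane \<rho>"
  shows "integrable M (\<lambda>\<omega>. 1 / ((1 - of_real (X \<omega>) * z) * (1 - of_real (X \<omega>) * w)))"
proof -
  obtain B where B: "B > 0" "\<And>u t. u \<in> {z, w} \<Longrightarrow> t \<in> {0..1/\<rho>} \<Longrightarrow> norm (1 / (1 - of_real t * u)) \<le> B"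
    using denominator_bound[of "{z, w}"] assms by auto
  have "norm (1 / ((1 - of_real (X \<omega>) * z) * (1 - of_real (X \<omega>) * w))) \<le> B * B" if "\<omega> \<in> space M" for \<omega>
  proof -
    have "norm (1 / ((1 - of_real (X \<omega>) * z) * (1 - of_real (X \<omega>) * w)))
        = norm (1 / (1 - of_real (X \<omega>) * z)) * norm (1 / (1 - of_real (X \<omega>) * w))"
      by (simp add: norm_divide norm_mult)
    also have "\<dots> \<le> B * B"
      using B(1) B(2)[OF _ X_range[OF that]] by (intro mult_mono) simp_all
    finally show ?thesis .
  qed
  then show ?thesis by (intro integrable_const_bound[of _ "B * B"]) auto
qed

lemma transform_diff:
  assumes "z \<in> cut_plane \<rho>" "w \<in> cut_plane \<rho>"
  shows "F z - F w = (z - w) * divided_difference z w"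
proof -
  have "F z - F w = (\<integral>\<omega>. z / (1 - of_real (X \<omega>) * z) - w / (1 - of_real (X \<omega>) * w) \<partial>M)"
    unfolding stieltjes_transform_def
    by (rule Bochner_Integration.integral_diff[OF integrable_kernel[OF assms(1)] integrable_kernel[OF assms(2)], symmetric])
  also have "\<dots> = (\<integral>\<omega>. (z - w) * (1 / ((1 - of_real (X \<omega>) * z) * (1 - of_real (X \<omega>) * w))) \<partial>M)"
  proof (rule Bochner_Integration.integral_cong[OF refl])
    fix \<omega> assume "\<omega> \<in> space M"
    then have "1 - of_real (X \<omega>) * z \<noteq> 0" "1 - of_real (X \<omega>) * w \<noteq> 0"
      using denominator_nonzero assms X_range by blast+
    then show "z / (1 - of_real (X \<omega>) * z) - w / (1 - of_real (X \<omega>) * w)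
        = (z - w) * (1 / ((1 - of_real (X \<omega>) * z) * (1 - of_real (X \<omega>) * w)))"
      by (simp add: field_simps)
  qed
  also have "\<dots> = (z - w) * divided_difference z w"
    unfolding divided_difference_def by (rule integral_mult_right_zero)
  finally show ?thesis .
qed

text \<open>The divided difference is continuous in its first argument, by the bound on the
  denominators near \<open>z\<close>.\<close>

lemma transform_has_derivative:
  assumes z: "z \<in> cut_plane \<rho>"
  shows "(F has_field_derivative divided_difference z z) (at z)"
proof -
  obtain r where r: "r > 0" "cball z r \<subseteq> cut_plane \<rho>"
    using open_contains_cball[of "cut_plane \<rho>"] open_cut_plane z by blast
  obtain B where B: "B > 0" "\<And>w t. w \<in> cball z r \<Longrightarrow> t \<in> {0..1/\<rho>} \<Longrightarrow> norm (1 / (1 - of_real t * w)) \<le> B"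
    using denominator_bound[of "cball z r"] r by auto
  have close: "norm (divided_difference w z - divided_difference z z) \<le> norm (w - z) * (B ^ 3 / \<rho>)" if w: "w \<in> cball z r" for w
  proof -
    have wcut: "w \<in> cut_plane \<rho>" using w r by auto
    let ?d = "\<lambda>\<omega>. 1 / ((1 - of_real (X \<omega>) * w) * (1 - of_real (X \<omega>) * z))
        - 1 / ((1 - of_real (X \<omega>) * z) * (1 - of_real (X \<omega>) * z))"
    have int: "integrable M ?d"
      by (rule Bochner_Integration.integrable_diff[OF integrable_divided_difference[OF wcut z] integrable_divided_difference[OF z z]])
    have bound: "norm (?d \<omega>) \<le> norm (w - z) * (B ^ 3 / \<rho>)" if \<omega>: "\<omega> \<in> space M" for \<omega>
    proof -
      let ?a = "1 / (1 - of_real (X \<omega>) * w)" and ?b = "1 / (1 - of_real (X \<omega>) * z)"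
      have nz: "1 - of_real (X \<omega>) * w \<noteq> 0" "1 - of_real (X \<omega>) * z \<noteq> 0"
        using denominator_nonzero wcut z X_range[OF \<omega>] by blast+
      have partial: "1 / (a * b) - 1 / (b * b) = (b - a) * (1 / a * (1 / b * (1 / b)))"
        if "a \<noteq> 0" "b \<noteq> 0" for a b :: complex
        using that by (simp add: field_simps)
      have "?d \<omega> = (of_real (X \<omega>) * (w - z)) * (?a * (?b * ?b))"
        unfolding partial[OF nz] by (simp only: right_diff_distrib diff_diff_eq2) simp
      then have "?d \<omega> = (w - z) * (of_real (X \<omega>) * (?a * (?b * ?b)))"
        by (simp only: mult_ac)
      also have "norm \<dots> = norm (w - z) * (X \<omega> * (norm ?a * (norm ?b * norm ?b)))"
        unfolding norm_mult using X_range[OF \<omega>] by simp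
      also have "\<dots> \<le> norm (w - z) * (1 / \<rho> * (B * (B * B)))"
      proof -
        have "norm ?a \<le> B" "norm ?b \<le> B" "0 \<le> X \<omega>" "X \<omega> \<le> 1 / \<rho>"
          using B(2)[OF w X_range[OF \<omega>]] B(2)[of z "X \<omega>"] r(1) X_range[OF \<omega>] by auto
        then show ?thesis
          by (intro mult_left_mono mult_mono mult_nonneg_nonneg norm_ge_zero) (use B(1) \<rho>_pos in auto)
      qed
      also have "\<dots> = norm (w - z) * (B ^ 3 / \<rho>)" by (simp add: power3_eq_cube)
      finally show ?thesis .
    qed
    have eq: "divided_difference w z - divided_difference z z = (\<integral>\<omega>. ?d \<omega> \<partial>M)"
      unfolding divided_difference_def
      by (rule Bochner_Integration.integral_diff[OF integrable_divided_difference[OF wcut z] integrable_divided_difference[OF z z], symmetric])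
    have "norm (divided_difference w z - divided_difference z z) \<le> (\<integral>\<omega>. norm (?d \<omega>) \<partial>M)"
      unfolding eq by (rule integral_norm_bound)
    also have "\<dots> \<le> (\<integral>\<omega>. norm (w - z) * (B ^ 3 / \<rho>) \<partial>M)"
      by (rule integral_mono[OF integrable_norm[OF int] integrable_const bound])
    also have "\<dots> = norm (w - z) * (B ^ 3 / \<rho>)" by (simp add: prob_space)
    finally show ?thesis .
  qed
  have "((\<lambda>w. divided_difference w z - divided_difference z z) \<longlongrightarrow> 0) (at z)"
  proof (rule Lim_null_comparison)
    show "\<forall>\<^sub>F w in at z. norm (divided_difference w z - divided_difference z z) \<le> norm (w - z) * (B ^ 3 / \<rho>)"
      using eventually_at_ball[OF r(1), of z UNIV] by eventually_elim (rule close, simp add: less_imp_le)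
    have "((\<lambda>w. norm (w - z) * (B ^ 3 / \<rho>)) \<longlongrightarrow> norm (z - z) * (B ^ 3 / \<rho>)) (at z)"
      by (intro tendsto_intros)
    then show "((\<lambda>w. norm (w - z) * (B ^ 3 / \<rho>)) \<longlongrightarrow> 0) (at z)" by simp
  qed
  then have "((\<lambda>w. divided_difference w z) \<longlongrightarrow> divided_difference z z) (at z)" by (rule LIM_zero_cancel)
  moreover have "\<forall>\<^sub>F w in at z. divided_difference w z = (F w - F z) / (w - z)"
    using eventually_at_ball[OF r(1), of z UNIV] eventually_neq_at_within[of z z UNIV]
  proof eventually_elim
    case (elim w)
    then have "w \<in> cut_plane \<rho>" using r(2) by auto
    then show ?case using transform_diff[of w z] z elim by simp
  qed
  ultimately have "((\<lambda>w. (F w - F z) / (w - z)) \<longlongrightarrow> divided_difference z z) (at z)"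
    by (rule Lim_transform_eventually)
  then show ?thesis by (simp add: has_field_derivative_iff)
qed

lemma transform_holomorphic: "F holomorphic_on cut_plane \<rho>"
  unfolding holomorphic_on_open[OF open_cut_plane] using transform_has_derivative by blast

end

section \<open>Univalence and images convex in the imaginary direction\<close>

text \<open>The level set is compact and the projection to the first coordinate is injective on it,
  hence a homeomorphism onto the interval.\<close>

lemma continuous_implicit_function:
  fixes h :: "real \<Rightarrow> real \<Rightarrow> real"
  assumes cont: "continuous_on ({a..b} \<times> {c..d}) (\<lambda>(s, y). h s y)"
    and ex1: "\<And>s. s \<in> {a..b} \<Longrightarrow> \<exists>!y. y \<in> {c..d} \<and> h s y = u"
  obtains Y where "continuous_on {a..b} Y" "\<And>s. s \<in> {a..b} \<Longrightarrow> Y s \<in> {c..d}" "\<And>s. s \<in> {a..b} \<Longrightarrow> h s (Y s) = u"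
proof -
  define Y where "Y s = (THE y. y \<in> {c..d} \<and> h s y = u)" for s
  have Y: "Y s \<in> {c..d}" "h s (Y s) = u" if "s \<in> {a..b}" for s
    using theI'[OF ex1[OF that]] by (auto simp: Y_def)
  define G where "G = {x \<in> {a..b} \<times> {c..d}. (\<lambda>(s, y). h s y) x = u}"
  have "closedin (top_of_set ({a..b} \<times> {c..d})) G"
    unfolding G_def by (rule continuous_closedin_preimage_constant[OF cont])
  then have "compact G"
    by (rule closedin_compact[rotated]) (simp add: compact_Times)
  moreover have inverse: "(fst x, Y (fst x)) = x" if "x \<in> G" for x
  proof -
    have "fst x \<in> {a..b}" "snd x \<in> {c..d}" "h (fst x) (snd x) = u"
      using that by (auto simp: G_def)
    then have "Y (fst x) = snd x" using ex1 Y by blast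
    then show ?thesis by simp
  qed
  ultimately have "continuous_on (fst ` G) (\<lambda>s. (s, Y s))"
    by (intro continuous_on_inv continuous_on_fst continuous_on_id ballI)
  moreover have "fst ` G = {a..b}"
  proof
    show "fst ` G \<subseteq> {a..b}" by (auto simp: G_def)
    show "{a..b} \<subseteq> fst ` G"
    proof
      fix s assume "s \<in> {a..b}"
      then have "(s, Y s) \<in> G" using Y[of s] by (simp add: G_def)
      then show "s \<in> fst ` G" by (metis fst_conv imageI)
    qed
  qed
  ultimately have "continuous_on {a..b} (\<lambda>s. snd (s, Y s))"
    by (intro continuous_on_snd) simp
  then have "continuous_on {a..b} Y" by simp
  with Y show thesis using that by blast
qed

text \<open>By symmetry under conjugation it suffices to reach the real axis from above.\<close>

lemma convex_vertical_slices:
  assumes cnj: "\<And>w. w \<in> D \<Longrightarrow> cnj w \<in> D"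
    and down: "\<And>w v. w \<in> D \<Longrightarrow> 0 < Im w \<Longrightarrow> 0 \<le> v \<Longrightarrow> v \<le> Im w \<Longrightarrow> Complex (Re w) v \<in> D"
  shows "convex (D \<inter> {w. Re w = x})"
proof (rule convexI)
  have inside: "w' \<in> D" if w: "w \<in> D" "Re w' = Re w" "\<bar>Im w'\<bar> \<le> \<bar>Im w\<bar>" for w w'
  proof (cases "Im w = 0")
    case True
    then have "w' = w" using w by (simp add: complex_eq_iff)
    then show ?thesis using w by simp
  next
    case False
    define u where "u = (if Im w > 0 then w else cnj w)"
    have "u \<in> D" "Im u = \<bar>Im w\<bar>" "Re u = Re w" using w cnj False by (auto simp: u_def)
    then have "Complex (Re w) \<bar>Im w'\<bar> \<in> D" using down[of u "\<bar>Im w'\<bar>"] w False by auto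
    moreover have "w' = Complex (Re w) \<bar>Im w'\<bar> \<or> w' = cnj (Complex (Re w) \<bar>Im w'\<bar>)"
      using w(2) by (auto simp: complex_eq_iff)
    ultimately show ?thesis using cnj by metis
  qed
  fix w1 w2 :: complex and s t :: real
  assume w: "w1 \<in> D \<inter> {w. Re w = x}" "w2 \<in> D \<inter> {w. Re w = x}" and st: "0 \<le> s" "0 \<le> t" "s + t = 1"
  let ?c = "s *\<^sub>R w1 + t *\<^sub>R w2"
  have "Re ?c = (s + t) * x" using w by (simp add: algebra_simps)
  then have Re: "Re ?c = x" using st by simp
  have "\<bar>Im ?c\<bar> \<le> s * \<bar>Im w1\<bar> + t * \<bar>Im w2\<bar>"
    using st abs_triangle_ineq[of "s * Im w1" "t * Im w2"] by (simp add: abs_mult)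
  also have "\<dots> \<le> max \<bar>Im w1\<bar> \<bar>Im w2\<bar>"
    using st by (intro convex_bound_le) auto
  finally have "\<bar>Im ?c\<bar> \<le> \<bar>Im w1\<bar> \<or> \<bar>Im ?c\<bar> \<le> \<bar>Im w2\<bar>" by linarith
  then show "?c \<in> D \<inter> {w. Re w = x}"
    using inside[of w1 ?c] inside[of w2 ?c] w Re by auto
qed

lemma maps_univalently_cong:
  assumes S: "open S" and eq: "\<And>z. z \<in> S \<Longrightarrow> f z = g z"
    and g: "maps_univalently_onto_convex_imag g S"
  shows "maps_univalently_onto_convex_imag f S"
proof -
  have "f ` S = g ` S" using eq by (intro image_cong) auto
  moreover have "inj_on f S \<longleftrightarrow> inj_on g S" using eq by (intro inj_on_cong) auto
  moreover have "f analytic_on S \<longleftrightarrow> g analytic_on S"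
    unfolding analytic_on_open[OF S] using eq by (intro holomorphic_cong) auto
  ultimately show ?thesis using g by (simp add: maps_univalently_onto_convex_imag_def)
qed

context poles_beyond
begin

lemma halfplane_subset_cut: "{z. Re z < \<rho>} \<subseteq> cut_plane \<rho>"
  by (auto simp: cut_plane_def)

lemma halfplane_in_cut: "Re z < \<rho> \<Longrightarrow> z \<in> cut_plane \<rho>"
  using halfplane_subset_cut by blast

lemma t_\<rho>_le_1: "t \<in> {0..1/\<rho>} \<Longrightarrow> t * \<rho> \<le> 1"
  using \<rho>_pos by (simp add: field_simps)

lemma Re_denominator_pos:
  assumes "Re z < \<rho>" "t \<in> {0..1/\<rho>}"
  shows "0 < 1 - t * Re z"
proof (cases "t = 0")
  case False
  then have "t * Re z < t * \<rho>" using assms by simp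
  then show ?thesis using t_\<rho>_le_1[OF assms(2)] by linarith
qed simp

text \<open>With \<open>v = (1 - tz)(1 - tw)\<close> it suffices to find a real \<open>K\<close> such that \<open>Re (1/v) + K Im
  (1/v)\<close> is positive for all admissible \<open>t\<close> at once. If \<open>z\<close> and \<open>w\<close> lie on opposite sides of the
  real axis, the arguments of the two factors partly cancel and \<open>K = 0\<close> works. Otherwise \<open>K\<close> is
  the ratio \<open>Im z/(\<rho> - Re z)\<close>, which bounds the slope \<open>t Im z/(1 - t Re z)\<close> of the first factor
  in absolute value.\<close>

lemma divided_difference_nonzero:
  assumes z: "Re z < \<rho>" and w: "Re w < \<rho>"
  shows "divided_difference z w \<noteq> 0"
proof -
  define K where "K = (if 0 \<le> Im z * Im w then Im z / (\<rho> - Re z) else 0)"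
  let ?v = "\<lambda>\<omega>. (1 - of_real (X \<omega>) * z) * (1 - of_real (X \<omega>) * w)"
  have cut: "z \<in> cut_plane \<rho>" "w \<in> cut_plane \<rho>" using z w halfplane_in_cut by auto
  have int: "integrable M (\<lambda>\<omega>. 1 / ?v \<omega>)" by (rule integrable_divided_difference[OF cut])
  have pos: "0 < Re (1 / ?v \<omega>) + K * Im (1 / ?v \<omega>)" if \<omega>: "\<omega> \<in> space M" for \<omega>
  proof -
    define t where "t = X \<omega>"
    define p where "p = 1 - t * Re z"
    define p' where "p' = 1 - t * Re w"
    have t: "0 \<le> t" "t * \<rho> \<le> 1" and p: "0 < p" "0 < p'"
      using X_range[OF \<omega>] t_\<rho>_le_1 Re_denominator_pos z w by (auto simp: t_def p_def p'_def)
    have nz: "?v \<omega> \<noteq> 0"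
      using denominator_nonzero[OF cut(1) X_range[OF \<omega>]] denominator_nonzero[OF cut(2) X_range[OF \<omega>]] by simp
    have Re_v: "Re (?v \<omega>) = p * p' - t * t * (Im z * Im w)"
      and Im_v: "Im (?v \<omega>) = - t * (p' * Im z + p * Im w)"
      by (simp_all add: t_def p_def p'_def algebra_simps)
    have num: "0 < Re (?v \<omega>) - K * Im (?v \<omega>)"
    proof (cases "0 \<le> Im z * Im w")
      case True
      have xz: "0 < \<rho> - Re z" using z by simp
      have Kz: "Im z = K * (\<rho> - Re z)" using True xz by (simp add: K_def)
      have "0 \<le> K * Im z" using xz by (simp add: K_def mult_ac)
      moreover have "0 \<le> K * Im w"
        using True xz by (simp add: K_def)
      ultimately have "0 \<le> t * p' * (K * Im z)" "0 \<le> t * (1 - t * \<rho>) * (K * Im w)"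
        using t p by (auto intro!: mult_nonneg_nonneg)
      moreover have "Re (?v \<omega>) - K * Im (?v \<omega>)
          = p * p' + t * p' * (K * Im z) + t * Im w * (K * p - t * Im z)"
        unfolding Re_v Im_v by (simp add: algebra_simps)
      moreover have "K * p - t * Im z = K * (1 - t * \<rho>)"
        by (subst Kz) (simp add: p_def algebra_simps)
      ultimately show ?thesis using mult_pos_pos[OF p] by (simp add: mult_ac)
    next
      case False
      then have "t * t * (Im z * Im w) \<le> 0"
        using t mult_nonneg_nonpos[of "t * t" "Im z * Im w"] by simp
      then have "0 < Re (?v \<omega>)" unfolding Re_v using mult_pos_pos[OF p] by linarith
      then show ?thesis using False by (simp only: K_def if_False mult_zero_left diff_0_right)
    qed
    have "Re (1 / u) + K * Im (1 / u) = (Re u - K * Im u) / (norm u)\<^sup>2" for u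
      by (simp add: Re_divide Im_divide cmod_power2 diff_divide_distrib)
    then show ?thesis using num nz by (simp only: zero_less_divide_iff) simp
  qed
  have "Re (divided_difference z w) + K * Im (divided_difference z w) = (\<integral>\<omega>. Re (1 / ?v \<omega>) + K * Im (1 / ?v \<omega>) \<partial>M)"
    unfolding divided_difference_def using int by simp
  also have "\<dots> > 0"
    by (rule integral_positive) (use int pos in auto)
  finally show ?thesis by auto
qed

lemma transform_inj: "inj_on F {z. Re z < \<rho>}"
proof (rule inj_onI)
  fix z w assume "z \<in> {z. Re z < \<rho>}" "w \<in> {z. Re z < \<rho>}" "F z = F w"
  then show "z = w"
    using transform_diff[of z w] divided_difference_nonzero[of z w] halfplane_in_cut by auto
qed

lemma transform_cnj: "F (cnj z) = cnj (F z)"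
proof -
  have "F (cnj z) = (\<integral>\<omega>. cnj (z / (1 - of_real (X \<omega>) * z)) \<partial>M)"
    unfolding stieltjes_transform_def by simp
  then show ?thesis unfolding stieltjes_transform_def by (simp only: Bochner_Integration.integral_cnj)
qed

lemma Im_transform:
  assumes "Re z < \<rho>"
  shows "Im z \<le> 0 \<Longrightarrow> Im (F z) \<le> 0" "0 \<le> Im z \<Longrightarrow> 0 \<le> Im (F z)"
proof -
  have "Im (F z) = (\<integral>\<omega>. Im (z / (1 - of_real (X \<omega>) * z)) \<partial>M)"
    unfolding stieltjes_transform_def
    using integrable_kernel[OF halfplane_in_cut[OF assms]] by simp
  also have "\<dots> = (\<integral>\<omega>. Im z / ((1 - X \<omega> * Re z)\<^sup>2 + (X \<omega> * Im z)\<^sup>2) \<partial>M)"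
    by (simp only: Im_kernel)
  finally have Im: "Im (F z) = (\<integral>\<omega>. Im z / ((1 - X \<omega> * Re z)\<^sup>2 + (X \<omega> * Im z)\<^sup>2) \<partial>M)" .
  show "0 \<le> Im z \<Longrightarrow> 0 \<le> Im (F z)"
    unfolding Im by (rule Bochner_Integration.integral_nonneg) simp
  assume "Im z \<le> 0"
  then have "0 \<le> (\<integral>\<omega>. - (Im z / ((1 - X \<omega> * Re z)\<^sup>2 + (X \<omega> * Im z)\<^sup>2)) \<partial>M)"
    by (intro Bochner_Integration.integral_nonneg) (simp add: divide_nonpos_nonneg)
  then show "Im (F z) \<le> 0" unfolding Im by simp
qed

lemma Re_transform:
  assumes "Re z < \<rho>"
  shows "integrable M (\<lambda>\<omega>. Re (z / (1 - of_real (X \<omega>) * z)))"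
    "Re (F z) = (\<integral>\<omega>. Re (z / (1 - of_real (X \<omega>) * z)) \<partial>M)"
  unfolding stieltjes_transform_def
  using integrable_kernel[OF halfplane_in_cut[OF assms]] by simp_all

lemma Re_transform_mono:
  assumes z: "Re z < \<rho>" and w: "Re w < \<rho>"
    and gap: "\<And>t. t \<in> {0..1/\<rho>} \<Longrightarrow> 0 \<le> kernel_gap t z w"
  shows "Re (F z) \<le> Re (F w)"
  unfolding Re_transform(2)[OF z] Re_transform(2)[OF w]
proof (rule integral_mono[OF Re_transform(1)[OF z] Re_transform(1)[OF w]])
  fix \<omega> assume "\<omega> \<in> space M"
  note t = X_range[OF this]
  show "Re (z / (1 - of_real (X \<omega>) * z)) \<le> Re (w / (1 - of_real (X \<omega>) * w))"
    using gap[OF t] Re_denominator_pos[OF z t] Re_denominator_pos[OF w t]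
    by (intro Re_kernel_mono) (simp_all only: kernel_gap_def)
qed

text \<open>Equality of the means would force the kernel values to agree almost surely, because they
  are ordered pointwise.\<close>

lemma Re_transform_strict_mono:
  assumes z: "Re z < \<rho>" and w: "Re w < \<rho>"
    and gap: "\<And>t. t \<in> {0..1/\<rho>} \<Longrightarrow> 0 \<le> kernel_gap t z w"
    and strict: "\<not> (AE \<omega> in M. kernel_gap (X \<omega>) z w = 0)"
  shows "Re (F z) < Re (F w)"
proof -
  let ?d = "\<lambda>\<omega>. Re (w / (1 - of_real (X \<omega>) * w)) - Re (z / (1 - of_real (X \<omega>) * z))"
  have int: "integrable M ?d"
    by (rule Bochner_Integration.integrable_diff[OF Re_transform(1)[OF w] Re_transform(1)[OF z]])
  have nonneg: "0 \<le> ?d \<omega>" and pos: "?d \<omega> = 0 \<Longrightarrow> kernel_gap (X \<omega>) z w = 0" if "\<omega> \<in> space M" for \<omega>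
  proof -
    note t = X_range[OF that]
    obtain C where "0 < C" "?d \<omega> = C * kernel_gap (X \<omega>) z w"
      using Re_kernel_difference[OF Re_denominator_pos[OF z t] Re_denominator_pos[OF w t]]
      unfolding kernel_gap_def by blast
    then show "0 \<le> ?d \<omega>" "?d \<omega> = 0 \<Longrightarrow> kernel_gap (X \<omega>) z w = 0" using gap[OF t] by auto
  qed
  have "(\<integral>\<omega>. ?d \<omega> \<partial>M) \<noteq> 0"
  proof
    assume "(\<integral>\<omega>. ?d \<omega> \<partial>M) = 0"
    then have "AE \<omega> in M. ?d \<omega> = 0"
      using integral_nonneg_eq_0_iff_AE[OF int] nonneg by simp
    then have "AE \<omega> in M. kernel_gap (X \<omega>) z w = 0"
      by (rule AE_mp) (use pos in \<open>auto intro!: AE_I2\<close>)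
    with strict show False ..
  qed
  moreover have "(\<integral>\<omega>. ?d \<omega> \<partial>M) \<ge> 0"
    by (rule Bochner_Integration.integral_nonneg) (rule nonneg)
  moreover have "(\<integral>\<omega>. ?d \<omega> \<partial>M) = Re (F w) - Re (F z)"
    unfolding Re_transform(2)[OF z] Re_transform(2)[OF w]
    by (rule Bochner_Integration.integral_diff[OF Re_transform(1)[OF w] Re_transform(1)[OF z]])
  ultimately show ?thesis by linarith
qed

lemma Re_transform_strict_mono':
  assumes "Re z < \<rho>" "Re w < \<rho>" "\<And>t. t \<in> {0..1/\<rho>} \<Longrightarrow> 0 < kernel_gap t z w"
  shows "Re (F z) < Re (F w)"
proof (rule Re_transform_strict_mono[OF assms(1,2)])
  show "\<not> (AE \<omega> in M. kernel_gap (X \<omega>) z w = 0)"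
  proof
    assume "AE \<omega> in M. kernel_gap (X \<omega>) z w = 0"
    then have "AE \<omega> in M. False"
      by (rule AE_mp[OF _ AE_I2]) (use assms(3) X_range in force)
    then show False by simp
  qed
qed (use assms(3) in \<open>auto intro: less_imp_le\<close>)

lemma Re_transform_real_axis:
  assumes "x < y" "y < \<rho>"
  shows "Re (F (of_real x)) < Re (F (of_real y))"
  using assms Re_denominator_pos[of "of_real x"] Re_denominator_pos[of "of_real y"]
  by (intro Re_transform_strict_mono') (auto simp: kernel_gap_def)

lemma Re_transform_circle:
  assumes "norm z = norm w" "norm w < \<rho>" "Re z < Re w"
  shows "Re (F z) < Re (F w)"
proof (rule Re_transform_strict_mono')
  show "Re z < \<rho>" "Re w < \<rho>" using assms abs_Re_le_cmod[of z] abs_Re_le_cmod[of w] by auto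
  fix t assume t: "t \<in> {0..1/\<rho>}"
  have "(t * norm w)\<^sup>2 < 1"
  proof (cases "t = 0")
    case False
    then have "t * norm w < t * \<rho>" using t assms by auto
    then have "t * norm w < 1" using t_\<rho>_le_1[OF t] by linarith
    then show ?thesis using t by (intro power_less_one_iff[THEN iffD2]) auto
  qed simp
  then show "0 < kernel_gap t z w"
    using assms by (simp add: kernel_gap_same_norm)
qed

text \<open>The hypothesis excludes \<open>F z = z\<close>, for which \<open>Re F\<close> is constant along vertical lines.\<close>

lemma Re_transform_vertical:
  assumes "\<not> (AE \<omega> in M. X \<omega> = 0)" "Re z = Re w" "Re w < \<rho>" "0 \<le> Im w" "Im w < Im z"
  shows "Re (F z) < Re (F w)"
proof (rule Re_transform_strict_mono)
  show "Re z < \<rho>" "Re w < \<rho>" using assms by auto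
  have gap: "kernel_gap t z w = t * (1 - t * Re w) * ((Im z)\<^sup>2 - (Im w)\<^sup>2)" for t
    using assms(2) by (simp add: kernel_gap_def algebra_simps)
  have sq: "(Im w)\<^sup>2 < (Im z)\<^sup>2" using assms by (intro power_strict_mono) auto
  show "0 \<le> kernel_gap t z w" if "t \<in> {0..1/\<rho>}" for t
    unfolding gap using that Re_denominator_pos[OF assms(3) that] sq by simp
  have "kernel_gap (X \<omega>) z w = 0 \<Longrightarrow> X \<omega> = 0" if "\<omega> \<in> space M" for \<omega>
    unfolding gap using Re_denominator_pos[OF assms(3) X_range[OF that]] sq by simp
  then show "\<not> (AE \<omega> in M. kernel_gap (X \<omega>) z w = 0)"
    using assms(1) by (metis (mono_tags, lifting) AE_I2 AE_mp)
qed

lemma transform_degenerate: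
  assumes "AE \<omega> in M. X \<omega> = 0"
  shows "F z = z"
proof -
  have "F z = (\<integral>\<omega>. z \<partial>M)"
    unfolding stieltjes_transform_def
  proof (rule integral_cong_AE)
    show "AE \<omega> in M. z / (1 - of_real (X \<omega>) * z) = z" using assms by eventually_elim simp
  qed auto
  then show ?thesis by (simp add: prob_space)
qed

lemma continuous_on_transform: "continuous_on {z. Re z < \<rho>} F"
  using holomorphic_on_imp_continuous_on[OF transform_holomorphic] continuous_on_subset halfplane_subset_cut by blast

lemma continuous_on_transform_compose:
  assumes "continuous_on A f" "continuous_on A g" "\<And>s. s \<in> A \<Longrightarrow> f s < \<rho>"
  shows "continuous_on A (\<lambda>s. F (Complex (f s) (g s)))"
  by (rule continuous_on_compose2[OF continuous_on_transform continuous_on_Complex[OF assms(1,2)]])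
    (use assms(3) in auto)

text \<open>Above each \<open>x\<close> the level is attained at most once, since \<open>Re F\<close> decreases strictly in
  \<open>y\<close>. It is attained for all \<open>x\<close> between \<open>Re z0\<close> and the real point \<open>x1\<close> of the same level: on
  the real axis \<open>Re F\<close> increases, so its value there is not below the level, and at the height
  \<open>Y1\<close> it is not above the level. Both comparisons hold pointwise for the kernel.\<close>

lemma level_curve:
  assumes nondeg: "\<not> (AE \<omega> in M. X \<omega> = 0)" and z0: "Re z0 < \<rho>" "0 < Im z0"
  obtains x1 Y where "x1 < Re z0" "continuous_on {x1..Re z0} Y" "Y x1 = 0" "Y (Re z0) = Im z0"
    "\<And>x. x \<in> {x1..Re z0} \<Longrightarrow> 0 \<le> Y x"
    "\<And>x. x \<in> {x1..Re z0} \<Longrightarrow> Re (F (Complex x (Y x))) = Re (F z0)"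
proof -
  define x0 where "x0 = Re z0"
  define y0 where "y0 = Im z0"
  define u where "u = Re (F z0)"
  \<comment> \<open>so far to the left that the kernel at \<open>xm\<close> has a real part not above that at \<open>z0\<close>, for every \<open>t\<close>\<close>
  define xm where "xm = x0 - y0\<^sup>2 / (\<rho> - x0)"
  define h where "h x y = Re (F (Complex x y))" for x y
  have x0: "0 < \<rho> - x0" and y0: "0 < y0" using z0 by (auto simp: x0_def y0_def)
  have xm: "xm < x0" using x0 y0 by (simp add: xm_def)
  have h0: "h x0 y0 = u" by (simp add: h_def u_def x0_def y0_def)
  have vertical: "h x y' < h x y" if "x < \<rho>" "0 \<le> y" "y < y'" for x y y'
    unfolding h_def using that by (intro Re_transform_vertical nondeg) auto
  have horizontal: "h x 0 \<le> h x' 0" if "x \<le> x'" "x' < \<rho>" for x x'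
    using Re_transform_real_axis[of x x'] that by (cases "x = x'") (auto simp: h_def complex_of_real_def)
  have "h xm 0 \<le> u"
    unfolding h_def u_def
  proof (rule Re_transform_mono)
    fix t assume t: "t \<in> {0..1/\<rho>}"
    have xm\<rho>: "Re (Complex xm 0) < \<rho>" using xm x0 by simp
    define k where "k = y0\<^sup>2 / (\<rho> - x0)"
    have k: "0 \<le> k" "y0\<^sup>2 = k * (\<rho> - x0)" "x0 - xm = k" using x0 by (simp_all add: k_def xm_def)
    have "kernel_gap t (Complex xm 0) z0 = (1 - t * xm) * ((1 - t * x0) * (x0 - xm) - t * y0\<^sup>2)"
      by (simp add: kernel_gap_def x0_def y0_def algebra_simps)
    also have "\<dots> = (1 - t * xm) * (k * (1 - t * \<rho>))"
      unfolding k(2,3) by (simp add: algebra_simps)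
    also have "\<dots> \<ge> 0"
      using Re_denominator_pos[OF xm\<rho> t] t_\<rho>_le_1[OF t] k(1) by simp
    finally show "0 \<le> kernel_gap t (Complex xm 0) z0" .
  qed (use xm x0 z0 in auto)
  moreover have "u < h x0 0" using vertical[of x0 0 y0] x0 y0 h0 by simp
  moreover have "continuous_on {xm..x0} (\<lambda>x. h x 0)"
    unfolding h_def using x0 by (intro continuous_intros continuous_on_transform_compose) auto
  ultimately obtain x1 where x1: "xm \<le> x1" "x1 \<le> x0" "h x1 0 = u"
    using IVT'[of "\<lambda>x. h x 0" xm u x0] xm by auto
  have x1x0: "x1 < x0" using x1 \<open>u < h x0 0\<close> by (cases "x1 = x0") auto
  define c where "c = sqrt ((\<rho> - x1) / (\<rho> - x0))"
  \<comment> \<open>the smallest factor that works for all \<open>x\<close> in \<open>[x1,x0]\<close> and all \<open>t\<close>: the ratio of the denominators at \<open>x1\<close> and \<open>x0\<close> is largest for \<open>t = 1/\<rho>\<close>\<close>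
  define Y1 where "Y1 = y0 * c"
  have c2: "c\<^sup>2 = (\<rho> - x1) / (\<rho> - x0)" using x0 x1x0 by (simp add: c_def)
  have "1 \<le> c" using x0 x1x0 by (simp add: c_def)
  then have Y1: "y0 \<le> Y1" using y0 by (simp add: Y1_def)
  have top: "h x Y1 \<le> u" if x: "x \<in> {x1..x0}" for x
    unfolding h_def u_def
  proof (rule Re_transform_mono)
    fix t assume t: "t \<in> {0..1/\<rho>}"
    define p where "p = 1 - t * x"
    define p0 where "p0 = 1 - t * x0"
    have p: "0 < p" "0 < p0"
      using Re_denominator_pos[of "of_real x" t] Re_denominator_pos[of "of_real x0" t] t x x0
      by (auto simp: p_def p0_def)
    have "p * (\<rho> - x0) \<le> (1 - t * x1) * (\<rho> - x0)"
      using x x0 t by (intro mult_right_mono) (auto simp: p_def mult_left_mono)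
    also have "\<dots> = p0 * (\<rho> - x1) - (x0 - x1) * (1 - t * \<rho>)"
      by (simp add: p0_def algebra_simps)
    also have "\<dots> \<le> p0 * (\<rho> - x1)" using x1x0 t_\<rho>_le_1[OF t] by simp
    finally have "p \<le> p0 * c\<^sup>2" using x0 by (simp add: c2 field_simps)
    then have "p * y0\<^sup>2 \<le> p0 * Y1\<^sup>2"
      using mult_right_mono[of p "p0 * c\<^sup>2" "y0\<^sup>2"] by (simp add: Y1_def power_mult_distrib mult_ac)
    then have "0 \<le> p * p0 * (x0 - x) + t * (p0 * Y1\<^sup>2 - p * y0\<^sup>2)"
      using p x t by (intro add_nonneg_nonneg mult_nonneg_nonneg) auto
    then show "0 \<le> kernel_gap t (Complex x Y1) z0"
      by (simp add: kernel_gap_def p_def p0_def x0_def y0_def)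
  qed (use x x0 z0 in auto)
  have ex1: "\<exists>!y. y \<in> {0..Y1} \<and> h x y = u" if x: "x \<in> {x1..x0}" for x
  proof (rule ex_ex1I)
    have "continuous_on {0..Y1} (\<lambda>y. h x y)"
      unfolding h_def using x x0 by (intro continuous_intros continuous_on_transform_compose) auto
    moreover have "u \<le> h x 0" using horizontal[of x1 x] x x1 x0 by simp
    ultimately show "\<exists>y. y \<in> {0..Y1} \<and> h x y = u"
      using IVT2'[of "\<lambda>y. h x y" Y1 u 0] top[OF x] Y1 y0 by auto
    fix y y' assume "y \<in> {0..Y1} \<and> h x y = u" "y' \<in> {0..Y1} \<and> h x y' = u"
    then show "y = y'"
      using vertical[of x y y'] vertical[of x y' y] x x0 by (cases y y' rule: linorder_cases) auto
  qed
  have "continuous_on ({x1..x0} \<times> {0..Y1}) (\<lambda>(x, y). h x y)"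
    unfolding h_def case_prod_unfold using x0
    by (intro continuous_intros continuous_on_transform_compose) auto
  from continuous_implicit_function[OF this ex1]
  obtain Y where Y: "continuous_on {x1..x0} Y" "\<And>x. x \<in> {x1..x0} \<Longrightarrow> Y x \<in> {0..Y1}"
    "\<And>x. x \<in> {x1..x0} \<Longrightarrow> h x (Y x) = u" by metis
  have unique: "Y x = y" if "x \<in> {x1..x0}" "0 \<le> y" "y \<le> Y1" "h x y = u" for x y
    using ex1[OF that(1)] Y(2,3)[OF that(1)] that by auto
  have "Y x1 = 0" using unique[of x1 0] x1 x1x0 Y1 y0 by simp
  moreover have "Y x0 = y0" using unique[of x0 y0] h0 x1x0 Y1 y0 by simp
  ultimately show thesis
    using that[of x1 Y] x1x0 Y by (auto simp: x0_def y0_def h_def u_def)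
qed

text \<open>Along the level curve \<open>Im F\<close> runs from \<open>0\<close> to \<open>Im (F z0)\<close>. If \<open>z0\<close> lies in the disc, the
  real end point of the curve has modulus less than \<open>|z0|\<close>, because \<open>-|z0|\<close> and \<open>|z0|\<close> give
  values of \<open>Re F\<close> on either side of the level. A curve leaving the disc would have to cross the
  circle through \<open>z0\<close> at a second point of the same level, contrary to \<open>Re_transform_circle\<close>.\<close>

lemma slice_below_attained:
  assumes z0: "Re z0 < \<rho>" "0 < Im z0" and v: "0 \<le> v" "v \<le> Im (F z0)"
  shows "\<exists>z. Re z < \<rho> \<and> F z = Complex (Re (F z0)) v \<and> (norm z0 < \<rho> \<longrightarrow> norm z < \<rho>)"
proof (cases "AE \<omega> in M. X \<omega> = 0")
  case True
  then have F: "F z = z" for z by (rule transform_degenerate)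
  have "norm (Complex (Re z0) v) \<le> norm z0"
    using v unfolding cmod_def F by (intro real_sqrt_le_mono add_left_mono power_mono) auto
  then show ?thesis using z0 v F by (intro exI[of _ "Complex (Re z0) v"]) auto
next
  case False
  obtain x1 Y where x1: "x1 < Re z0" and Y: "continuous_on {x1..Re z0} Y" "Y x1 = 0" "Y (Re z0) = Im z0"
    "\<And>x. x \<in> {x1..Re z0} \<Longrightarrow> 0 \<le> Y x"
    "\<And>x. x \<in> {x1..Re z0} \<Longrightarrow> Re (F (Complex x (Y x))) = Re (F z0)"
    using level_curve[OF False z0] by blast
  have cont: "continuous_on {x1..Re z0} (\<lambda>x. Im (F (Complex x (Y x))))"
    using z0 by (intro continuous_intros continuous_on_transform_compose Y(1)) auto
  have "Im (F (Complex x1 (Y x1))) = 0"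
    using Im_transform[of "Complex x1 0"] x1 z0 by (simp add: Y(2))
  then obtain x where x: "x1 \<le> x" "x \<le> Re z0" "Im (F (Complex x (Y x))) = v"
    using IVT'[OF _ _ _ cont, of v] v x1 Y(3) by auto
  have "norm (Complex x (Y x)) < \<rho>" if "norm z0 < \<rho>"
  proof (rule ccontr)
    assume far: "\<not> norm (Complex x (Y x)) < \<rho>"
    define r where "r = norm z0"
    have "(Re z0)\<^sup>2 < r\<^sup>2" using z0 by (simp add: r_def cmod_power2)
    moreover have "0 \<le> r" by (simp add: r_def)
    ultimately have "\<bar>Re z0\<bar> < r" by (intro power2_less_imp_less[of "\<bar>Re z0\<bar>"]) (simp_all only: power2_abs)
    then have r: "r < \<rho>" "0 < r" "\<bar>Re z0\<bar> < r"
      using that by (auto simp: r_def)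
    let ?m = "\<lambda>s. norm (Complex s (Y s))"
    have x1_lower: "- r < x1"
    proof (rule ccontr)
      assume "\<not> - r < x1"
      then have "Re (F (of_real x1)) \<le> Re (F (of_real (- r)))"
        using Re_transform_real_axis[of x1 "-r"] r by (cases "x1 = - r") auto
      also have "\<dots> < Re (F z0)" using r by (intro Re_transform_circle) (auto simp: r_def)
      finally show False using Y(5)[of x1] x1 Y(2) by (simp add: complex_of_real_def)
    qed
    have "\<bar>x1\<bar> < r" using x1_lower x1 r by auto
    then have "?m x1 \<le> r" by (simp add: Y(2) cmod_def)
    moreover have "continuous_on {x1..x} ?m"
      using x by (intro continuous_intros continuous_on_Complex continuous_on_subset[OF Y(1)]) auto
    ultimately obtain s where s: "x1 \<le> s" "s \<le> x" "?m s = r"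
      using IVT'[of ?m x1 r x] far r x by auto
    have "s \<noteq> Re z0" using s x far r Y(3) by (auto simp: complex_eq_iff r_def)
    then have "Re (F (Complex s (Y s))) < Re (F z0)"
      using s x r by (intro Re_transform_circle) (auto simp: r_def)
    then show False using Y(5)[of s] s x by simp
  qed
  then show ?thesis
    using x z0 Y(5)[of x] by (intro exI[of _ "Complex x (Y x)"]) (auto simp: complex_eq_iff)
qed

lemma transform_univalent_convex:
  assumes S: "open S" "connected S" "S \<noteq> {}" "S \<subseteq> {z. Re z < \<rho>}" "\<And>z. z \<in> S \<Longrightarrow> cnj z \<in> S"
    and slice: "\<And>z v. z \<in> S \<Longrightarrow> 0 < Im z \<Longrightarrow> 0 \<le> v \<Longrightarrow> v \<le> Im (F z) \<Longrightarrow> Complex (Re (F z)) v \<in> F ` S"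
  shows "maps_univalently_onto_convex_imag F S"
  unfolding maps_univalently_onto_convex_imag_def domain_convex_imag_dir_def
proof (intro conjI allI)
  have holo: "F holomorphic_on S"
    using transform_holomorphic S(4) halfplane_subset_cut by (meson holomorphic_on_subset subset_trans)
  then show "F analytic_on S" using S(1) by (simp add: analytic_on_open)
  show inj: "inj_on F S" using transform_inj S(4) by (rule inj_on_subset)
  show "open (F ` S)" by (rule open_mapping_thm3[OF holo S(1) inj])
  show "connected (F ` S)"
    by (rule connected_continuous_image[OF holomorphic_on_imp_continuous_on[OF holo] S(2)])
  show "F ` S \<noteq> {}" using S(3) by simp
  show "convex (F ` S \<inter> {w. Re w = x})" for x
  proof (rule convex_vertical_slices)
    show "cnj w \<in> F ` S" if "w \<in> F ` S" for w
    proof -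
      obtain z where "z \<in> S" "w = F z" using \<open>w \<in> F ` S\<close> by blast
      then show ?thesis using S(5)[of z] by (simp add: transform_cnj[symmetric])
    qed
    fix w v assume w: "w \<in> F ` S" "0 < Im w" "0 \<le> v" "v \<le> Im w"
    then obtain z where z: "z \<in> S" "w = F z" by blast
    moreover have "0 < Im z" using Im_transform(1)[of z] z w(2) S(4) by force
    ultimately show "Complex (Re w) v \<in> F ` S" using slice w by blast
  qed
qed

theorem transform_halfplane: "maps_univalently_onto_convex_imag F {z. Re z < \<rho>}"
proof (rule transform_univalent_convex)
  show "open {z. Re z < \<rho>}" by (rule open_halfspace_Re_lt)
  show "connected {z. Re z < \<rho>}" by (rule convex_connected) (rule convex_halfspace_Re_lt)
  have "0 \<in> {z. Re z < \<rho>}" using \<rho>_pos by simp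
  then show "{z. Re z < \<rho>} \<noteq> {}" by blast
  show "Complex (Re (F z)) v \<in> F ` {z. Re z < \<rho>}"
    if z: "z \<in> {z. Re z < \<rho>}" "0 < Im z" "0 \<le> v" "v \<le> Im (F z)" for z v
  proof -
    obtain z' where "Re z' < \<rho>" "F z' = Complex (Re (F z)) v"
      using slice_below_attained[of z v] z by blast
    then show ?thesis by (metis (mono_tags) imageI mem_Collect_eq)
  qed
qed auto

theorem transform_disc: "maps_univalently_onto_convex_imag F (ball 0 \<rho>)"
proof (rule transform_univalent_convex)
  show sub: "ball 0 \<rho> \<subseteq> {z. Re z < \<rho>}"
  proof
    fix z :: complex assume "z \<in> ball 0 \<rho>"
    then show "z \<in> {z. Re z < \<rho>}" using complex_Re_le_cmod[of z] by simp
  qed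
  show "Complex (Re (F z)) v \<in> F ` ball 0 \<rho>"
    if z: "z \<in> ball 0 \<rho>" "0 < Im z" "0 \<le> v" "v \<le> Im (F z)" for z v
  proof -
    have "norm z < \<rho>" "Re z < \<rho>" using z(1) sub by auto
    then obtain z' where "norm z' < \<rho>" "F z' = Complex (Re (F z)) v"
      using slice_below_attained[of z v] z by blast
    then show ?thesis by (metis imageI mem_ball_0)
  qed
qed (use \<rho>_pos in auto)

end

section \<open>Analytic continuation and the location of poles\<close>

context poles_beyond
begin

definition moment :: "nat \<Rightarrow> real" where
  "moment n = (\<integral>\<omega>. X \<omega> ^ n \<partial>M)"

lemma integrable_power: "integrable M (\<lambda>\<omega>. X \<omega> ^ n)"
proof (rule integrable_const_bound[of _ "(1 / \<rho>) ^ n"])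
  show "AE \<omega> in M. norm (X \<omega> ^ n) \<le> (1 / \<rho>) ^ n"
    using X_range by (intro AE_I2) (auto simp: norm_power intro!: power_mono)
qed simp

text \<open>Geometric expansion of the kernel, integrated term by term. The common value \<open>S\<close> is \<open>F z
  / z\<close> without the exceptional case \<open>z = 0\<close>.\<close>

lemma transform_sums:
  assumes z: "norm z < \<rho>"
  obtains S where "(\<lambda>n. of_real (moment n) * z ^ n) sums S" "F z = z * S"
proof -
  define r where "r = norm z / \<rho>"
  have r: "0 \<le> r" "r < 1" using z \<rho>_pos by (simp_all add: r_def)
  define f where "f n \<omega> = (of_real (X \<omega>) * z) ^ n" for n \<omega>
  have f_int: "integrable M (f n)" for n
    unfolding f_def[abs_def] power_mult_distrib of_real_power[symmetric]
    by (intro integrable_mult_left integrable_of_real integrable_power)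
  have tz: "norm (of_real (X \<omega>) * z) \<le> r" if "\<omega> \<in> space M" for \<omega>
    using mult_right_mono[of "X \<omega>" "1 / \<rho>" "norm z"] X_range[OF that] by (simp add: norm_mult r_def)
  have f_bound: "norm (f n \<omega>) \<le> r ^ n" if "\<omega> \<in> space M" for n \<omega>
    unfolding f_def norm_power using tz[OF that] by (rule power_mono) simp
  have "summable (\<lambda>n. r ^ n)" using r by (intro summable_geometric) simp
  have sum_pt: "summable (\<lambda>n. norm (f n \<omega>))" if "\<omega> \<in> space M" for \<omega>
    by (rule summable_comparison_test'[OF \<open>summable (\<lambda>n. r ^ n)\<close>, of 0]) (use f_bound[OF that] in simp)
  have sum_int: "summable (\<lambda>n. \<integral>\<omega>. norm (f n \<omega>) \<partial>M)"
  proof (rule summable_comparison_test'[OF \<open>summable (\<lambda>n. r ^ n)\<close>, of 0])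
    fix n
    have "(\<integral>\<omega>. norm (f n \<omega>) \<partial>M) \<le> (\<integral>\<omega>. r ^ n \<partial>M)"
      by (rule integral_mono[OF integrable_norm[OF f_int] integrable_const f_bound])
    then show "norm (\<integral>\<omega>. norm (f n \<omega>) \<partial>M) \<le> r ^ n" by (simp add: prob_space)
  qed
  have "(\<lambda>n. integral\<^sup>L M (f n)) sums (\<integral>\<omega>. (\<Sum>n. f n \<omega>) \<partial>M)"
    by (rule sums_integral[OF f_int AE_I2[OF sum_pt] sum_int])
  moreover have "integral\<^sup>L M (f n) = of_real (moment n) * z ^ n" for n
  proof -
    have "integral\<^sup>L M (f n) = (\<integral>\<omega>. of_real (X \<omega> ^ n) * z ^ n \<partial>M)"
      by (simp only: f_def[abs_def] power_mult_distrib of_real_power)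
    also have "\<dots> = (\<integral>\<omega>. of_real (X \<omega> ^ n) \<partial>M) * z ^ n"
      by (rule integral_mult_left_zero)
    also have "\<dots> = of_real (moment n) * z ^ n"
      by (simp only: integral_complex_of_real moment_def)
    finally show ?thesis .
  qed
  ultimately have sums: "(\<lambda>n. of_real (moment n) * z ^ n) sums (\<integral>\<omega>. (\<Sum>n. f n \<omega>) \<partial>M)" by simp
  have "F z = (\<integral>\<omega>. z * (\<Sum>n. f n \<omega>) \<partial>M)"
    unfolding stieltjes_transform_def
  proof (rule Bochner_Integration.integral_cong[OF refl])
    fix \<omega> assume "\<omega> \<in> space M"
    then have "norm (of_real (X \<omega>) * z) < 1" using tz r by (meson le_less_trans)
    then show "z / (1 - of_real (X \<omega>) * z) = z * (\<Sum>n. f n \<omega>)"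
      by (simp add: f_def suminf_geometric)
  qed
  then have "F z = z * (\<integral>\<omega>. (\<Sum>n. f n \<omega>) \<partial>M)" by (simp only: integral_mult_right_zero)
  with sums that show thesis by blast
qed

lemma moment_Markov:
  assumes "0 \<le> s"
  shows "measure M {\<omega> \<in> space M. s \<le> X \<omega>} * s ^ n \<le> moment n"
proof -
  let ?A = "{\<omega> \<in> space M. s \<le> X \<omega>}"
  have "measure M ?A * s ^ n = (\<integral>\<omega>. indicator ?A \<omega> * s ^ n \<partial>M)"
    by simp
  also have "\<dots> \<le> moment n"
    unfolding moment_def
  proof (rule integral_mono[OF _ integrable_power])
    show "integrable M (\<lambda>\<omega>. indicator ?A \<omega> * s ^ n)"
      by (intro integrable_mult_left integrable_real_indicator) (auto simp: less_top[symmetric])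
    show "indicator ?A \<omega> * s ^ n \<le> X \<omega> ^ n" if "\<omega> \<in> space M" for \<omega>
      using X_range[OF that] assms by (auto simp: indicator_def intro!: power_mono)
  qed
  finally show ?thesis .
qed

text \<open>The extension has the same Taylor coefficients as \<open>F\<close> and its Taylor series converges in
  the larger disc.\<close>

lemma moment_decay_of_extension:
  assumes h: "h holomorphic_on ball 0 R" and hF: "\<And>z. z \<in> ball 0 \<rho> \<Longrightarrow> h z = F z"
    and r: "0 \<le> r" "r < R"
  shows "(\<lambda>n. moment n * r ^ Suc n) \<longlonglongrightarrow> 0"
proof -
  define c where "c n = (deriv ^^ n) h 0 / fact n" for n
  define d where "d n = (case n of 0 \<Rightarrow> 0 | Suc k \<Rightarrow> complex_of_real (moment k))" for n
  have h_sums: "(\<lambda>n. c n * z ^ n) sums h z" if "z \<in> ball 0 R" for z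
    using holomorphic_power_series[OF h that] by (simp add: c_def)
  have F_sums: "(\<lambda>n. d n * z ^ n) sums F z" if "z \<in> ball 0 \<rho>" for z
  proof -
    obtain S where S: "(\<lambda>n. of_real (moment n) * z ^ n) sums S" "F z = z * S"
      using transform_sums[of z] \<open>z \<in> ball 0 \<rho>\<close> by auto
    have "(\<lambda>n. d (Suc n) * z ^ Suc n) sums (z * S)"
      using sums_mult[OF S(1), of z] by (simp add: d_def mult_ac)
    then show ?thesis using sums_Suc_iff[of "\<lambda>n. d n * z ^ n" "z * S"] S(2) by (simp add: d_def)
  qed
  have "R > 0" using r by simp
  have "\<forall>\<^sub>F z in nhds 0. z \<in> ball (0::complex) R \<inter> ball 0 \<rho>"
    using \<rho>_pos \<open>R > 0\<close> by (intro eventually_nhds_in_open) auto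
  then have "h has_fps_expansion Abs_fps c" "h has_fps_expansion Abs_fps d"
    by (intro has_fps_expansionI; eventually_elim; use h_sums F_sums hF in force)+
  then have "Abs_fps c = Abs_fps d" by (rule fps_expansion_unique_complex)
  then have cd: "c n = d n" for n by (metis fps_nth_Abs_fps)
  have "of_real r \<in> ball (0::complex) R" using r by simp
  then have "(\<lambda>n. c n * of_real r ^ n) \<longlonglongrightarrow> 0"
    using h_sums by (intro summable_LIMSEQ_zero sums_summable) blast
  then have "(\<lambda>n. norm (c (Suc n) * of_real r ^ Suc n)) \<longlonglongrightarrow> 0"
    by (intro tendsto_norm_zero LIMSEQ_Suc)
  moreover have "norm (c (Suc n) * of_real r ^ Suc n) = moment n * r ^ Suc n" for n
  proof -
    have "0 \<le> moment n" unfolding moment_def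
      using X_range by (intro Bochner_Integration.integral_nonneg zero_le_power) auto
    then show ?thesis using r by (simp add: cd d_def norm_mult norm_power del: power_Suc)
  qed
  ultimately show ?thesis by simp
qed

text \<open>By Markov's inequality the moments grow at least like \<open>s\<^sup>n\<close> for every \<open>s\<close> which \<open>X\<close>
  exceeds with positive probability.\<close>

lemma extension_bounds_poles:
  assumes h: "h holomorphic_on ball 0 R" and hF: "\<And>z. z \<in> ball 0 \<rho> \<Longrightarrow> h z = F z" and R: "0 < R"
  shows "AE \<omega> in M. X \<omega> \<le> 1 / R"
proof -
  have null: "AE \<omega> in M. X \<omega> < s" if s: "1 / R < s" for s
  proof -
    let ?p = "measure M {\<omega> \<in> space M. s \<le> X \<omega>}"
    have "0 < 1 / R" using R by simp
    then have s0: "0 < s" using s by linarith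
    have "1 / s < R" using s s0 R by (simp add: field_simps)
    \<comment> \<open>radii in this range lie inside the disc of convergence but make \<open>s r\<close> at least \<open>1\<close>\<close>
    then obtain r where r: "1 / s < r" "r < R" using dense by blast
    have r0: "0 < r" using r(1) s0 by (meson divide_pos_pos less_trans zero_less_one)
    have "1 \<le> s * r" using r(1) s0 by (simp add: field_simps)
    have lower: "?p * r \<le> moment n * r ^ Suc n" for n
    proof -
      have "?p * r * 1 \<le> ?p * r * (s * r) ^ n"
        using r0 \<open>1 \<le> s * r\<close> by (intro mult_left_mono one_le_power) auto
      also have "\<dots> = ?p * s ^ n * r ^ Suc n" by (simp add: power_mult_distrib)
      also have "\<dots> \<le> moment n * r ^ Suc n"
        using moment_Markov[of s n] s0 r0 by (intro mult_right_mono) auto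
      finally show ?thesis by simp
    qed
    have "?p * r \<le> 0"
      using moment_decay_of_extension[OF h hF, of r] r r0 lower
      by (intro LIMSEQ_le_const[of "\<lambda>n. moment n * r ^ Suc n"]) auto
    then have "?p \<le> 0" using r0 by (simp add: mult_le_0_iff)
    then have "?p = 0" using measure_nonneg[of M "{\<omega> \<in> space M. s \<le> X \<omega>}"] by linarith
    then have "AE \<omega> in M. \<not> s \<le> X \<omega>" by (subst (asm) prob_eq_0) auto
    then show ?thesis by eventually_elim simp
  qed
  have "AE \<omega> in M. \<forall>n. X \<omega> < 1 / R + 1 / real (Suc n)"
    unfolding AE_all_countable by (intro allI null) simp
  then show ?thesis
  proof eventually_elim
    case (elim \<omega>)
    show ?case
    proof (rule field_le_epsilon)
      fix e :: real assume "0 < e"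
      then obtain n where "1 / real (Suc n) < e" by (meson nat_approx_posE)
      then show "X \<omega> \<le> 1 / R + e" using elim[rule_format, of n] by simp
    qed
  qed
qed

text \<open>Replacing \<open>X\<close> by its truncation at \<open>1/R\<close> changes it on a null set only, and places all
  poles at distance \<open>R\<close> or more.\<close>

theorem extension_univalent_convex:
  assumes h: "h holomorphic_on ball 0 R" and hF: "\<And>z. z \<in> ball 0 \<rho> \<Longrightarrow> h z = F z" and R: "\<rho> \<le> R"
  shows "maps_univalently_onto_convex_imag h (ball 0 R)"
proof -
  have R0: "0 < R" using R \<rho>_pos by simp
  define X' where "X' \<omega> = min (X \<omega>) (1 / R)" for \<omega>
  interpret X': poles_beyond M X' R
  proof
    show "X' \<in> borel_measurable M" unfolding X'_def by measurable
    show "X' \<omega> \<in> {0..1/R}" if "\<omega> \<in> space M" for \<omega>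
      using X_range[OF that] R0 by (auto simp: X'_def)
  qed (rule R0)
  have "AE \<omega> in M. X \<omega> = X' \<omega>"
  proof -
    have "AE \<omega> in M. X \<omega> \<le> 1 / R" by (rule extension_bounds_poles[OF h _ R0]) (rule hF)
    then show ?thesis by eventually_elim (simp add: X'_def)
  qed
  then have same: "F z = X'.F z" for z
    unfolding stieltjes_transform_def by (intro integral_cong_AE) (auto elim: eventually_mono)
  have sub: "ball 0 R \<subseteq> cut_plane R"
    by (auto simp: cut_plane_def)
  have eq: "h z = X'.F z" if "z \<in> ball 0 R" for z
  proof (rule analytic_continuation_open[of "ball 0 \<rho>" "ball 0 R" h X'.F, OF _ _ _ _ _ h _ _ that])
    show "X'.F holomorphic_on ball 0 R"
      by (rule holomorphic_on_subset[OF X'.transform_holomorphic sub])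
    show "h w = X'.F w" if "w \<in> ball 0 \<rho>" for w
      using hF[OF that] same by simp
  qed (use R \<rho>_pos in auto)
  show ?thesis by (rule maps_univalently_cong[OF open_ball eq X'.transform_disc])
qed

end

section \<open>Heine's functions and their contiguous relation\<close>

definition heine_coeff :: "real \<Rightarrow> real \<times> real \<times> real \<Rightarrow> nat \<Rightarrow> real" where
  "heine_coeff q = (\<lambda>(a, b, c) n. q_shifted_fact a q n * q_shifted_fact b q n /
     (q_shifted_fact c q n * q_shifted_fact q q n))"

definition heine_fun :: "real \<Rightarrow> real \<times> real \<times> real \<Rightarrow> complex \<Rightarrow> complex" where
  "heine_fun q p z = (\<Sum>n. of_real (heine_coeff q p n) * z ^ n)"

text \<open>Two steps multiply \<open>a\<close> and \<open>b\<close> by \<open>q\<close> and \<open>c\<close> by \<open>q\<^sup>2\<close>. The swap of the first two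
  parameters makes the two alternating contiguous relations instances of a single one.\<close>

definition heine_shift :: "real \<Rightarrow> real \<times> real \<times> real \<Rightarrow> real \<times> real \<times> real" where
  "heine_shift q = (\<lambda>(a, b, c). (b * q, a, c * q))"

text \<open>The hypotheses on the parameters in a form stable under \<open>heine_shift\<close>; the boundary case
  \<open>a = c\<close> has to be included, since the shift of a triple with \<open>b = c\<close> has this form.\<close>

definition heine_admissible :: "real \<Rightarrow> real \<times> real \<times> real \<Rightarrow> bool" where
  "heine_admissible q = (\<lambda>(a, b, c). 0 \<le> c \<and> c < 1 \<and> c \<le> a \<and> a \<le> 1 \<and> c \<le> b \<and> b * q \<le> 1)"

text \<open>The number \<open>g\<^sub>k\<close> of the chain sequence belonging to the \<open>k\<close>-th parameter triple.\<close>

definition heine_chain :: "real \<times> real \<times> real \<Rightarrow> real" where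
  "heine_chain = (\<lambda>(a, b, c). (a - c) / (1 - c))"

lemma q_shifted_fact_of_real:
  "q_shifted_fact (of_real a) (of_real q) n = (of_real (q_shifted_fact a q n) :: complex)"
  by (simp add: q_shifted_fact_def)

lemma heine_Phi_eq_heine_fun: "heine_Phi (of_real a) (of_real b) (of_real c) (of_real q) z = heine_fun q (a, b, c) z"
  by (simp add: heine_Phi_def heine_fun_def heine_coeff_def q_shifted_fact_of_real)

lemma q_shifted_fact_0 [simp]: "q_shifted_fact a q 0 = 1"
  by (simp add: q_shifted_fact_def)

lemma q_shifted_fact_Suc: "q_shifted_fact a q (Suc n) = q_shifted_fact a q n * (1 - a * q ^ n)"
  by (simp add: q_shifted_fact_def)

lemma q_shifted_fact_Suc': "q_shifted_fact a q (Suc n) = (1 - a) * q_shifted_fact (a * q) q n"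
  by (simp add: q_shifted_fact_def prod.lessThan_Suc_shift mult_ac del: prod.lessThan_Suc)

context
  fixes q :: real
  assumes q: "0 < q" "q < 1"
begin

lemma q_power_le_1: "q ^ n \<le> 1"
  using q by (simp add: power_le_one)

lemma q_shifted_fact_pos:
  assumes "0 \<le> c" "c < 1"
  shows "0 < q_shifted_fact c q n"
  unfolding q_shifted_fact_def
proof (rule prod_pos)
  fix k
  have "c * q ^ k \<le> c * 1" by (intro mult_left_mono q_power_le_1 assms)
  then show "0 < 1 - c * q ^ k" using assms by simp
qed

lemma q_shifted_fact_le_1:
  assumes "0 \<le> a" "a \<le> 1"
  shows "\<bar>q_shifted_fact a q n\<bar> \<le> 1"
  unfolding q_shifted_fact_def abs_prod
proof (rule prod_le_1)
  fix k
  have "a * q ^ k \<le> 1 * 1" by (intro mult_mono q_power_le_1) (use assms q in auto)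
  moreover have "0 \<le> a * q ^ k" using assms q by simp
  ultimately show "0 \<le> \<bar>1 - a * q ^ k\<bar> \<and> \<bar>1 - a * q ^ k\<bar> \<le> 1" by auto
qed

text \<open>Only the first factor \<open>1 - b\<close> may exceed \<open>1\<close> in absolute value.\<close>

lemma q_shifted_fact_le_inverse:
  assumes "0 \<le> b" "b * q \<le> 1"
  shows "\<bar>q_shifted_fact b q n\<bar> \<le> 1 / q"
proof (cases n)
  case 0
  then show ?thesis using q by simp
next
  case (Suc m)
  have b: "b \<le> 1 / q" using assms q by (simp add: field_simps)
  have "1 \<le> 1 / q" using q by simp
  then have "\<bar>1 - b\<bar> \<le> 1 / q" using assms b by linarith
  then have "\<bar>1 - b\<bar> * \<bar>q_shifted_fact (b * q) q m\<bar> \<le> 1 / q * 1"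
    using assms q by (intro mult_mono q_shifted_fact_le_1) auto
  then show ?thesis by (simp add: Suc q_shifted_fact_Suc' abs_mult)
qed

lemma q_shifted_fact_ge:
  assumes "0 \<le> c" "c < 1"
  shows "(1 - c) * q_shifted_fact q q n \<le> q_shifted_fact c q n"
proof (cases n)
  case 0
  then show ?thesis using assms by simp
next
  case (Suc m)
  have "q_shifted_fact q q (Suc m) \<le> q_shifted_fact q q m"
    using q q_shifted_fact_pos[of q m] by (simp add: q_shifted_fact_Suc mult_left_le)
  also have "\<dots> \<le> q_shifted_fact (c * q) q m"
    unfolding q_shifted_fact_def
  proof (rule prod_mono)
    fix i
    have "q * q ^ i \<le> 1 * 1" by (intro mult_mono q_power_le_1) (use q in auto)
    moreover have "c * q * q ^ i \<le> 1 * (q * q ^ i)"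
      unfolding mult.assoc using assms q by (intro mult_right_mono) auto
    ultimately show "0 \<le> 1 - q * q ^ i \<and> 1 - q * q ^ i \<le> 1 - c * q * q ^ i" by simp
  qed
  finally show ?thesis
    unfolding Suc q_shifted_fact_Suc'[of c] using assms by (intro mult_left_mono) auto
qed

text \<open>The bound depends on \<open>c\<close> only through \<open>1 - c\<close>, which the shift of parameters does not
  decrease. It therefore serves for all \<open>\<Phi>\<^sub>k\<close> simultaneously.\<close>

lemma heine_coeff_bound:
  assumes "heine_admissible q (a, b, c)"
  shows "\<bar>heine_coeff q (a, b, c) n\<bar> \<le> 1 / (q * (1 - c)) * (1 / (q_shifted_fact q q n)\<^sup>2)"
proof -
  have adm: "0 \<le> c" "c < 1" "0 \<le> a" "a \<le> 1" "0 \<le> b" "b * q \<le> 1"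
    using assms by (auto simp: heine_admissible_def)
  let ?Q = "q_shifted_fact q q n"
  have Q: "0 < ?Q" using q by (intro q_shifted_fact_pos) auto
  have "0 < (1 - c) * ?Q * ?Q" using Q adm by simp
  have "\<bar>heine_coeff q (a, b, c) n\<bar> = \<bar>q_shifted_fact a q n\<bar> * \<bar>q_shifted_fact b q n\<bar> / (q_shifted_fact c q n * ?Q)"
    using Q q_shifted_fact_pos[of c n] adm by (simp add: heine_coeff_def abs_mult)
  also have "\<dots> \<le> (1 * (1 / q)) / ((1 - c) * ?Q * ?Q)"
    by (intro frac_le mult_mono mult_right_mono q_shifted_fact_le_1 q_shifted_fact_le_inverse q_shifted_fact_ge)
      (use adm q Q in auto)
  also have "\<dots> = 1 / (q * (1 - c)) * (1 / ?Q\<^sup>2)" by (simp add: power2_eq_square)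
  finally show ?thesis .
qed

lemma summable_heine_majorant:
  assumes "0 \<le> r" "r < 1"
  shows "summable (\<lambda>n. 1 / (q_shifted_fact q q n)\<^sup>2 * r ^ n)"
proof -
  have "(\<lambda>n. r / (1 - q * q ^ n)\<^sup>2) \<longlonglongrightarrow> r / (1 - q * 0)\<^sup>2"
    using q by (intro tendsto_intros LIMSEQ_power_zero) auto
  moreover have "r / (1 - q * 0)\<^sup>2 < (1 + r) / 2" using assms by simp
  ultimately have "\<forall>\<^sub>F n in sequentially. r / (1 - q * q ^ n)\<^sup>2 < (1 + r) / 2"
    by (rule order_tendstoD(2))
  then obtain N where N: "\<And>n. n \<ge> N \<Longrightarrow> r / (1 - q * q ^ n)\<^sup>2 < (1 + r) / 2"
    by (auto simp: eventually_at_top_linorder)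
  show ?thesis
  proof (rule summable_ratio_test[of "(1 + r) / 2" N])
    fix n assume "N \<le> n"
    let ?f = "\<lambda>n. 1 / (q_shifted_fact q q n)\<^sup>2 * r ^ n"
    have f: "0 \<le> ?f n" for n using assms by simp
    have "?f (Suc n) = r / (1 - q * q ^ n)\<^sup>2 * ?f n"
      by (simp add: q_shifted_fact_Suc power_mult_distrib)
    also have "\<dots> \<le> (1 + r) / 2 * ?f n"
      using N[OF \<open>N \<le> n\<close>] f by (intro mult_right_mono) auto
    finally show "norm (?f (Suc n)) \<le> (1 + r) / 2 * norm (?f n)"
      using f[of n] f[of "Suc n"] by (simp only: real_norm_def abs_of_nonneg)
  qed (use assms in simp)
qed

lemma summable_norm_heine:
  assumes "heine_admissible q p" "norm z < 1"
  shows "summable (\<lambda>n. norm (of_real (heine_coeff q p n) * z ^ n :: complex))"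
proof -
  obtain a b c where p: "p = (a, b, c)" by (cases p)
  have "summable (\<lambda>n. 1 / (q * (1 - c)) * (1 / (q_shifted_fact q q n)\<^sup>2 * norm z ^ n))"
    using assms by (intro summable_mult summable_heine_majorant) auto
  then show ?thesis
  proof (rule summable_comparison_test'[where N = 0])
    fix n
    show "norm (norm (of_real (heine_coeff q p n) * z ^ n :: complex))
        \<le> 1 / (q * (1 - c)) * (1 / (q_shifted_fact q q n)\<^sup>2 * norm z ^ n)"
      using mult_right_mono[OF heine_coeff_bound[of a b c n], of "norm z ^ n"] assms(1)
      by (simp add: norm_mult norm_power p)
  qed
qed

lemma heine_fun_sums:
  assumes "heine_admissible q p" "norm z < 1"
  shows "(\<lambda>n. of_real (heine_coeff q p n) * z ^ n) sums heine_fun q p z"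
  unfolding heine_fun_def
  by (intro summable_sums summable_norm_cancel[OF summable_norm_heine] assms)

lemma heine_fun_holomorphic:
  assumes "heine_admissible q p"
  shows "heine_fun q p holomorphic_on ball 0 1"
  by (rule power_series_holomorphic[where a = "\<lambda>n. of_real (heine_coeff q p n)"])
    (use heine_fun_sums[OF assms] in auto)

lemma heine_fun_0: "heine_fun q p 0 = 1"
proof -
  have "heine_coeff q p 0 = 1" by (simp add: heine_coeff_def case_prod_unfold)
  then show ?thesis by (simp add: heine_fun_def powser_zero)
qed

lemma heine_admissible_shift:
  assumes "heine_admissible q p"
  shows "heine_admissible q (heine_shift q p)"
proof -
  obtain a b c where p: "p = (a, b, c)" by (cases p)
  have adm: "0 \<le> c" "c < 1" "c \<le> a" "a \<le> 1" "c \<le> b" "b * q \<le> 1"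
    using assms by (auto simp: heine_admissible_def p)
  have "c * q \<le> c" "a * q \<le> a" using adm q by (simp_all add: mult_right_le_one_le)
  then show ?thesis using adm q by (auto simp: heine_admissible_def heine_shift_def p)
qed

lemma heine_admissible_shifts:
  "heine_admissible q p \<Longrightarrow> heine_admissible q ((heine_shift q ^^ k) p)"
  by (induction k) (auto intro: heine_admissible_shift)

lemma heine_chain_range:
  assumes "heine_admissible q p"
  shows "heine_chain p \<in> {0..1}"
  using assms by (cases p) (auto simp: heine_admissible_def heine_chain_def)

text \<open>After division by the common factor \<open>(1 - a)(aq;q)\<^sub>n(bq;q)\<^sub>n / ((cq\<^sup>2;q)\<^sub>n(q;q)\<^sub>n)\<close> the
  relation becomes, with \<open>Q = q\<^sup>n\<^sup>+\<^sup>1\<close>, the identity \<open>(1 - b)(1 - cQ) = (1 - bQ)(1 - c) - (b - c)(1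
  - Q)\<close>.\<close>

lemma heine_contiguous:
  assumes "heine_admissible q p"
  shows "heine_coeff q p (Suc n) * q = heine_coeff q (heine_shift q p) (Suc n) * q
    - (1 - heine_chain p) * heine_chain (heine_shift q p) * heine_coeff q (heine_shift q (heine_shift q p)) n"
proof -
  obtain a b c where p: "p = (a, b, c)" by (cases p)
  have c: "0 \<le> c" "c < 1" using assms by (auto simp: heine_admissible_def p)
  define A where "A = q_shifted_fact (a * q) q n"
  define B where "B = q_shifted_fact (b * q) q n"
  define C where "C = q_shifted_fact (c * q * q) q n"
  define D where "D = q_shifted_fact q q n"
  define Q where "Q = q ^ Suc n"
  have cq: "c * q < 1"
    using c q mult_strict_mono[of c 1 q 1] by (cases "c = 0") auto
  have cqq: "c * q * q < 1"
    using cq q c mult_le_one[of "c * q" q] by (cases "c = 0") (auto intro: le_less_trans[OF mult_left_le])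
  have "c * Q \<le> c * 1" unfolding Q_def by (intro mult_left_mono q_power_le_1 c)
  then have cQ: "1 - c * Q \<noteq> 0" using c by auto
  have Q: "1 - Q \<noteq> 0" using q power_Suc_less_one[of q n] by (simp add: Q_def)
  have C: "0 < C" unfolding C_def using cqq c q by (intro q_shifted_fact_pos) auto
  have D: "0 < D" unfolding D_def using q by (intro q_shifted_fact_pos) auto
  have qa: "q_shifted_fact a q (Suc n) = (1 - a) * A"
    and qb: "q_shifted_fact b q (Suc n) = (1 - b) * B"
    and qcq: "q_shifted_fact (c * q) q (Suc n) = (1 - c * q) * C"
    by (simp_all add: A_def B_def C_def q_shifted_fact_Suc')
  have qbq: "q_shifted_fact (b * q) q (Suc n) = B * (1 - b * Q)"
    and qq: "q_shifted_fact q q (Suc n) = D * (1 - Q)"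
    by (simp_all add: B_def D_def Q_def q_shifted_fact_Suc mult_ac)
  have "q_shifted_fact (c * q) q n * (1 - c * Q) = (1 - c * q) * C"
    using qcq by (simp add: q_shifted_fact_Suc Q_def mult_ac)
  then have "q_shifted_fact (c * q) q n = (1 - c * q) * C / (1 - c * Q)"
    using cQ by (simp add: nonzero_eq_divide_eq)
  then have qc: "q_shifted_fact c q (Suc n) = (1 - c) * ((1 - c * q) * C / (1 - c * Q))"
    by (simp only: q_shifted_fact_Suc')
  have nz: "1 - c \<noteq> 0" "1 - c * q \<noteq> 0" "C \<noteq> 0" "D \<noteq> 0" using c cq C D by auto
  define k where "k = (1 - a) * A * B / (C * D)"
  have l1: "heine_coeff q p (Suc n) = k * ((1 - b) * (1 - c * Q) / ((1 - c) * (1 - c * q) * (1 - Q)))"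
    unfolding p heine_coeff_def prod.case qa qb qc qq k_def using nz cQ Q by (simp add: field_simps)
  have l2: "heine_coeff q (heine_shift q p) (Suc n) = k * ((1 - b * Q) / ((1 - c * q) * (1 - Q)))"
    unfolding p heine_shift_def heine_coeff_def prod.case qa qbq qcq qq k_def using nz Q by (simp add: field_simps)
  have "heine_coeff q (heine_shift q (heine_shift q p)) n = A * B / (C * D)"
    unfolding p heine_shift_def heine_coeff_def prod.case A_def B_def C_def D_def by simp
  moreover have "1 - heine_chain p = (1 - a) / (1 - c)"
    unfolding p heine_chain_def prod.case using nz by (simp add: field_simps)
  moreover have "heine_chain (heine_shift q p) = q * (b - c) / (1 - c * q)"
    unfolding p heine_chain_def heine_shift_def prod.case by (simp add: algebra_simps)
  ultimately have l3: "(1 - heine_chain p) * heine_chain (heine_shift q p) * heine_coeff q (heine_shift q (heine_shift q p)) n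
      = k * (q * ((b - c) / ((1 - c) * (1 - c * q))))"
    unfolding k_def by (simp add: mult_ac)
  have "(1 - b) * (1 - c * Q) = (1 - b * Q) * (1 - c) - (b - c) * (1 - Q)"
    by (simp add: algebra_simps)
  then have "(1 - b) * (1 - c * Q) / ((1 - c) * (1 - c * q) * (1 - Q))
      = ((1 - b * Q) * (1 - c) - (b - c) * (1 - Q)) / ((1 - c) * (1 - c * q) * (1 - Q))"
    by (simp only:)
  also have "\<dots> = (1 - b * Q) / ((1 - c * q) * (1 - Q)) - (b - c) / ((1 - c) * (1 - c * q))"
    using nz Q by (simp add: diff_divide_distrib)
  finally have split: "(1 - b) * (1 - c * Q) / ((1 - c) * (1 - c * q) * (1 - Q))
      = (1 - b * Q) / ((1 - c * q) * (1 - Q)) - (b - c) / ((1 - c) * (1 - c * q))" .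
  have "k * (x - y) * q = k * x * q - k * (q * y)" for x y by (simp add: algebra_simps)
  then show ?thesis unfolding l1 l2 l3 split .
qed

text \<open>The series \<open>\<Phi>\<^sub>k(qw)\<close> satisfy the recurrence of a continued fraction with chain sequence
  coefficients; the factors \<open>q\<^sup>n\<^sup>-\<^sup>i\<close> undo the substitution \<open>z = qw\<close>.\<close>

lemma heine_ratio_moments:
  assumes adm: "heine_admissible q p"
  obtains M :: "real measure" and X where "prob_space M" "X \<in> borel_measurable M" "\<And>\<omega>. X \<omega> \<in> {0..1}"
    "\<And>n. heine_coeff q (heine_shift q p) n = (\<Sum>i\<le>n. heine_coeff q p i * ((\<integral>\<omega>. X \<omega> ^ (n - i) \<partial>M) / q ^ (n - i)))"
proof -
  \<comment> \<open>the series \<open>A k\<close> is the expansion of \<open>\<Phi>\<^sub>k(qw)\<close> in powers of \<open>w\<close>\<close>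
  define par where "par k = (heine_shift q ^^ k) p" for k
  have par: "heine_admissible q (par k)" "heine_shift q (par k) = par (Suc k)" for k
    using heine_admissible_shifts[OF adm] by (simp_all add: par_def)
  define g where "g k = heine_chain (par k)" for k
  have g: "g k \<in> {0..1}" for k unfolding g_def by (rule heine_chain_range[OF par(1)])
  define A where "A k = Abs_fps (\<lambda>n. heine_coeff q (par k) n * q ^ n)" for k
  have A0: "fps_nth (A k) 0 = 1" for k
    by (simp add: A_def heine_coeff_def case_prod_unfold)
  have "A k = A (Suc k) - fps_const ((1 - g k) * g (Suc k)) * fps_X * A (Suc (Suc k))" for k
  proof (rule fps_ext)
    fix n
    show "fps_nth (A k) n = fps_nth (A (Suc k) - fps_const ((1 - g k) * g (Suc k)) * fps_X * A (Suc (Suc k))) n"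
    proof (cases n)
      case 0
      then show ?thesis by (simp add: A0 mult.assoc)
    next
      case (Suc m)
      have "heine_coeff q (par k) (Suc m) * q = heine_coeff q (par (Suc k)) (Suc m) * q
          - (1 - g k) * g (Suc k) * heine_coeff q (par (Suc (Suc k))) m"
        using heine_contiguous[OF par(1)[of k], of m] by (simp only: par(2) g_def)
      from arg_cong[OF this, of "\<lambda>x. x * q ^ m"] show ?thesis
        by (simp add: Suc A_def mult.assoc fps_mult_left_const_nth algebra_simps)
    qed
  qed
  then have A1: "A 1 = A 0 * Abs_fps (chain_moment g)"
    by (rule chain_fraction_moments[OF g A0])
  obtain M :: "real measure" and X where MX: "prob_space M" "X \<in> borel_measurable M" "\<And>\<omega>. X \<omega> \<in> {0..1}"
    and mom: "\<And>n. chain_moment g n = (\<integral>\<omega>. X \<omega> ^ n \<partial>M)"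
    using hausdorff_moment_problem[OF completely_monotone_chain_moment[of g, OF g] chain_moment_0[of g]] by metis
  have "heine_coeff q (heine_shift q p) n = (\<Sum>i\<le>n. heine_coeff q p i * ((\<integral>\<omega>. X \<omega> ^ (n - i) \<partial>M) / q ^ (n - i)))" for n
  proof -
    have "fps_nth (A 1) n = (\<Sum>i\<le>n. heine_coeff q p i * q ^ i * (\<integral>\<omega>. X \<omega> ^ (n - i) \<partial>M))"
      unfolding A1 by (simp add: fps_mult_nth A_def par_def mom atLeast0AtMost)
    also have "\<dots> = (\<Sum>i\<le>n. heine_coeff q p i * ((\<integral>\<omega>. X \<omega> ^ (n - i) \<partial>M) / q ^ (n - i))) * q ^ n"
      unfolding sum_distrib_right
    proof (intro sum.cong refl)
      fix i assume "i \<in> {..n}"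
      then have "q ^ n = q ^ i * q ^ (n - i)" by (simp flip: power_add)
      then show "heine_coeff q p i * q ^ i * (\<integral>\<omega>. X \<omega> ^ (n - i) \<partial>M)
          = heine_coeff q p i * ((\<integral>\<omega>. X \<omega> ^ (n - i) \<partial>M) / q ^ (n - i)) * q ^ n"
        using q by simp
    qed
    finally show ?thesis using q by (simp add: A_def par_def)
  qed
  then show thesis using that[OF MX] by blast
qed

section \<open>The quotient of contiguous Heine functions\<close>

text \<open>The slit disc is starlike about \<open>0\<close>, since a ray from \<open>0\<close> that has met \<open>[q,\<infinity>)\<close> stays in
  it.\<close>

lemma slit_disc:
  "open (ball 0 1 \<inter> cut_plane q)" "connected (ball 0 1 \<inter> cut_plane q)" "ball 0 q \<subseteq> ball 0 1 \<inter> cut_plane q"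
proof -
  show "open (ball 0 1 \<inter> cut_plane q)" by (intro open_Int open_ball open_cut_plane)
  have sub: "ball 0 q \<subseteq> cut_plane q" by (auto simp: cut_plane_def)
  then show "ball 0 q \<subseteq> ball 0 1 \<inter> cut_plane q" using q by auto
  have "starlike (ball 0 1 \<inter> cut_plane q)"
    unfolding starlike_def
  proof (intro bexI[of _ 0] ballI)
    show "0 \<in> ball 0 1 \<inter> cut_plane q" using q sub by auto
    fix z assume z: "z \<in> ball 0 1 \<inter> cut_plane q"
    show "closed_segment 0 z \<subseteq> ball 0 1 \<inter> cut_plane q"
    proof
      fix w assume "w \<in> closed_segment 0 z"
      then obtain u where u: "0 \<le> u" "u \<le> 1" "w = u *\<^sub>R z" by (auto simp: in_segment)
      have "norm w \<le> norm z" using u by (simp add: mult_left_le_one_le)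
      moreover have "w \<in> cut_plane q"
      proof (rule ccontr)
        assume "w \<notin> cut_plane q"
        then have w: "u * Im z = 0" "q \<le> u * Re z" by (auto simp: cut_plane_eq u)
        then have "0 < u" using u q by (cases "u = 0") auto
        then have "0 < Re z" using w q by (smt (verit) mult_nonneg_nonpos)
        then have "u * Re z \<le> 1 * Re z" using u(2) by (intro mult_right_mono) auto
        then have "q \<le> Re z" using w(2) by linarith
        moreover have "Im z = 0" using w \<open>0 < u\<close> by simp
        ultimately show False using z by (simp add: cut_plane_eq)
      qed
      ultimately show "w \<in> ball 0 1 \<inter> cut_plane q" using z by simp
    qed
  qed
  then show "connected (ball 0 1 \<inter> cut_plane q)" by (rule starlike_imp_connected)
qed

text \<open>In the small disc this is the Cauchy product of power series; both sides are holomorphic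
  in the slit disc. The identity is stated without a quotient because the absence of zeros of
  \<open>\<Phi>\<^sub>0\<close> is deduced from it.\<close>

lemma heine_ratio_transform:
  assumes adm: "heine_admissible q p"
  obtains M :: "real measure" and X where "poles_beyond M X q"
    "\<And>z. z \<in> ball 0 1 \<inter> cut_plane q \<Longrightarrow>
       z * heine_fun q (heine_shift q p) z = heine_fun q p z * stieltjes_transform M X z"
proof -
  obtain M :: "real measure" and X0 where M: "prob_space M" "X0 \<in> borel_measurable M" "\<And>\<omega>. X0 \<omega> \<in> {0..1}"
    and coeff: "\<And>n. heine_coeff q (heine_shift q p) n
       = (\<Sum>i\<le>n. heine_coeff q p i * ((\<integral>\<omega>. X0 \<omega> ^ (n - i) \<partial>M) / q ^ (n - i)))"
    by (rule heine_ratio_moments[OF adm]) (rule that; assumption)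
  define X where "X \<omega> = X0 \<omega> / q" for \<omega>
  interpret prob_space M by fact
  interpret poles_beyond M X q
  proof
    show "X \<in> borel_measurable M" unfolding X_def using M(2) by measurable
    show "X \<omega> \<in> {0..1/q}" for \<omega> using M(3)[of \<omega>] q by (auto simp: X_def divide_right_mono)
  qed (rule q)
  have mom: "moment n = (\<integral>\<omega>. X0 \<omega> ^ n \<partial>M) / q ^ n" for n
    by (simp add: moment_def X_def power_divide)
  have near0: "z * heine_fun q (heine_shift q p) z = heine_fun q p z * F z" if z: "z \<in> ball 0 q" for z
  proof -
    have z1: "norm z < 1" "norm z < q" using z q by auto
    obtain S where S: "(\<lambda>n. of_real (moment n) * z ^ n) sums S" "F z = z * S"
      using transform_sums[OF z1(2)] by blast
    have m_bound: "norm (of_real (moment n) * z ^ n) \<le> (norm z / q) ^ n" for n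
    proof -
      have "moment n \<le> (\<integral>\<omega>. (1 / q) ^ n \<partial>M)"
        unfolding moment_def using X_range
        by (intro integral_mono integrable_power power_mono) auto
      moreover have "0 \<le> moment n"
        unfolding moment_def using X_range by (intro Bochner_Integration.integral_nonneg) auto
      ultimately have "\<bar>moment n\<bar> \<le> (1 / q) ^ n" by (simp add: prob_space)
      from mult_right_mono[OF this, of "norm z ^ n"] show ?thesis
        by (simp add: norm_mult norm_power power_divide)
    qed
    have "summable (\<lambda>n. (norm z / q) ^ n)" using z1 q by (intro summable_geometric) simp
    then have "summable (\<lambda>n. norm (of_real (moment n) * z ^ n))"
      by (rule summable_comparison_test'[of _ 0]) (use m_bound in simp)
    from Cauchy_product_sums[OF summable_norm_heine[OF adm z1(1)] this]
    have "(\<lambda>n. \<Sum>i\<le>n. of_real (heine_coeff q p i) * z ^ i * (of_real (moment (n - i)) * z ^ (n - i))) sums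
        (heine_fun q p z * S)"
      using sums_unique[OF S(1)] by (simp add: heine_fun_def)
    also have "(\<lambda>n. \<Sum>i\<le>n. of_real (heine_coeff q p i) * z ^ i * (of_real (moment (n - i)) * z ^ (n - i)))
        = (\<lambda>n. of_real (heine_coeff q (heine_shift q p) n) * z ^ n)"
    proof
      fix n
      have "(\<Sum>i\<le>n. of_real (heine_coeff q p i) * z ^ i * (of_real (moment (n - i)) * z ^ (n - i)))
          = (\<Sum>i\<le>n. of_real (heine_coeff q p i * moment (n - i)) * z ^ n)"
      proof (intro sum.cong refl)
        fix i assume "i \<in> {..n}"
        then have "z ^ n = z ^ i * z ^ (n - i)" by (simp flip: power_add)
        then show "of_real (heine_coeff q p i) * z ^ i * (of_real (moment (n - i)) * z ^ (n - i))
            = of_real (heine_coeff q p i * moment (n - i)) * z ^ n" by simp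
      qed
      then show "(\<Sum>i\<le>n. of_real (heine_coeff q p i) * z ^ i * (of_real (moment (n - i)) * z ^ (n - i)))
          = of_real (heine_coeff q (heine_shift q p) n) * z ^ n"
        by (simp only: coeff mom of_real_sum sum_distrib_right)
    qed
    finally have "heine_fun q p z * S = heine_fun q (heine_shift q p) z"
      using heine_fun_sums[OF heine_admissible_shift[OF adm] z1(1)] sums_unique2 by blast
    then show ?thesis using S(2) by simp
  qed
  have "z * heine_fun q (heine_shift q p) z = heine_fun q p z * F z"
    if z: "z \<in> ball 0 1 \<inter> cut_plane q" for z
  proof (rule analytic_continuation_open[OF _ slit_disc(1) _ slit_disc(2,3) _ _ near0 z])
    show "open (ball (0::complex) q)" "ball (0::complex) q \<noteq> {}" using q by auto
    have holo: "heine_fun q p' holomorphic_on ball 0 1 \<inter> cut_plane q" if "heine_admissible q p'" for p'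
      using heine_fun_holomorphic[OF that] by (rule holomorphic_on_subset) auto
    show "(\<lambda>z. z * heine_fun q (heine_shift q p) z) holomorphic_on ball 0 1 \<inter> cut_plane q"
      by (rule holomorphic_on_mult[OF holomorphic_on_ident holo[OF heine_admissible_shift[OF adm]]])
    have "F holomorphic_on ball 0 1 \<inter> cut_plane q"
      using transform_holomorphic by (rule holomorphic_on_subset) auto
    then show "(\<lambda>z. heine_fun q p z * F z) holomorphic_on ball 0 1 \<inter> cut_plane q"
      by (rule holomorphic_on_mult[OF holo[OF adm]])
  qed
  then show thesis by (rule that[OF poles_beyond_axioms])
qed

lemma heine_shift_even:
  "(heine_shift q ^^ (2 * k)) (a, b, c) = (a * q ^ k, b * q ^ k, c * q ^ (2 * k))"
  by (induction k) (simp_all add: heine_shift_def mult_ac)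

text \<open>All parameters tend to \<open>0\<close>, and \<open>heine_coeff_bound\<close> is a common majorant.\<close>

lemma heine_fun_shift_limit:
  assumes adm: "heine_admissible q p" and z: "norm z < 1"
  shows "(\<lambda>k. heine_fun q ((heine_shift q ^^ (2 * k)) p) z) \<longlonglongrightarrow> heine_fun q (0, 0, 0) z"
proof -
  obtain a b c where p: "p = (a, b, c)" by (cases p)
  have c: "0 \<le> c" "c < 1" using adm by (auto simp: p heine_admissible_def)
  let ?par = "\<lambda>k. (a * q ^ k, b * q ^ k, c * q ^ (2 * k))"
  have fact_lim: "(\<lambda>k. q_shifted_fact (x k) q n) \<longlonglongrightarrow> q_shifted_fact 0 q n" if "x \<longlonglongrightarrow> 0" for x :: "nat \<Rightarrow> real" and n
    unfolding q_shifted_fact_def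
    by (rule tendsto_eq_intros tendsto_prod that refl | simp)+
  have pow: "(\<lambda>k. q ^ k) \<longlonglongrightarrow> 0" using q by (intro LIMSEQ_power_zero) auto
  have lims: "(\<lambda>k. x * q ^ k) \<longlonglongrightarrow> 0" for x using tendsto_mult_left[OF pow, of x] by simp
  have "(\<lambda>k. q ^ (2 * k)) \<longlonglongrightarrow> 0" unfolding power_mult using q
    by (intro LIMSEQ_power_zero) (auto simp: power_less_one_iff abs_square_less_1)
  then have lims2: "(\<lambda>k. c * q ^ (2 * k)) \<longlonglongrightarrow> 0" using tendsto_mult_left[of _ 0 _ c] by simp
  have coeff_lim: "(\<lambda>k. of_real (heine_coeff q (?par k) n) * z ^ n) \<longlonglongrightarrow> of_real (heine_coeff q (0, 0, 0) n) * z ^ n" for n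
    unfolding heine_coeff_def prod.case
    using q_shifted_fact_pos[of 0 n] q_shifted_fact_pos[of q n] q
    by (intro tendsto_mult tendsto_of_real tendsto_divide fact_lim lims lims2 tendsto_const) auto
  define B where "B n = 1 / (q * (1 - c)) * (1 / (q_shifted_fact q q n)\<^sup>2 * norm z ^ n)" for n
  have bound: "norm (of_real (heine_coeff q (?par k) n) * z ^ n) \<le> B n" for k n
  proof -
    have adm_k: "heine_admissible q (?par k)"
      using heine_admissible_shifts[OF adm, of "2 * k"] by (simp only: p heine_shift_even)
    have "c * q ^ (2 * k) \<le> c" using c q by (simp add: mult_right_le_one_le power_le_one)
    then have "1 / (q * (1 - c * q ^ (2 * k))) \<le> 1 / (q * (1 - c))"
      using c q by (intro divide_left_mono mult_left_mono mult_pos_pos) auto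
    then have "\<bar>heine_coeff q (?par k) n\<bar> \<le> 1 / (q * (1 - c)) * (1 / (q_shifted_fact q q n)\<^sup>2)"
      using heine_coeff_bound[OF adm_k, of n] by (elim order_trans) (rule mult_right_mono, auto)
    from mult_right_mono[OF this, of "norm z ^ n"] show ?thesis
      by (simp add: norm_mult norm_power B_def)
  qed
  have B: "summable B"
    unfolding B_def using z by (intro summable_mult summable_heine_majorant) auto
  define summand where "summand n k = of_real (heine_coeff q (?par k) n) * z ^ n" for n k
  have "\<forall>\<^sub>F (n, k) in sequentially \<times>\<^sub>F sequentially. norm (summand n k) \<le> B n"
    by (rule always_eventually) (simp add: summand_def bound)
  from tannerys_theorem[OF coeff_lim[folded summand_def] this B]
  have "(\<lambda>k. \<Sum>n. summand n k) \<longlonglongrightarrow> (\<Sum>n. of_real (heine_coeff q (0, 0, 0) n) * z ^ n)"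
    by simp
  then show ?thesis by (simp only: p heine_shift_even heine_fun_def summand_def)
qed

text \<open>The coefficients \<open>e\<^sub>n = 1/(q;q)\<^sub>n\<close> satisfy \<open>e\<^sub>n\<^sub>+\<^sub>1 (1 - q\<^sup>n\<^sup>+\<^sup>1) = e\<^sub>n\<close>. Iterated, the equation
  gives Euler's product \<open>E(z) = \<Prod> 1/(1 - z q\<^sup>k)\<close>.\<close>

lemma heine_fun_000_functional_equation:
  assumes z: "norm z < 1"
  shows "(1 - z) * heine_fun q (0, 0, 0) z = heine_fun q (0, 0, 0) (of_real q * z)"
proof -
  let ?e = "\<lambda>n. complex_of_real (heine_coeff q (0, 0, 0) n)" and ?E = "heine_fun q (0, 0, 0)"
  have adm: "heine_admissible q (0, 0, 0)" by (simp add: heine_admissible_def)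
  have qz: "norm (of_real q * z) < 1"
    using q z mult_strict_mono[of q 1 "norm z" 1] by (simp add: norm_mult)
  have step: "heine_coeff q (0, 0, 0) (Suc n) * (1 - q ^ Suc n) = heine_coeff q (0, 0, 0) n" for n
    using power_Suc_less_one[of q n] q by (simp add: heine_coeff_def q_shifted_fact_Suc)
  define f where "f n = ?e n * z ^ n - ?e n * (of_real q * z) ^ n" for n
  have f: "f sums (?E z - ?E (of_real q * z))"
    unfolding f_def by (intro sums_diff heine_fun_sums[OF adm] z qz)
  have "f (Suc n) = z * (?e n * z ^ n)" for n
  proof -
    have "f (Suc n) = of_real (heine_coeff q (0, 0, 0) (Suc n) * (1 - q ^ Suc n)) * z ^ Suc n"
      by (simp add: f_def power_mult_distrib algebra_simps)
    then show ?thesis by (simp only: step) simp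
  qed
  then have "(\<lambda>n. f (Suc n)) sums (z * ?E z)"
    using sums_mult[OF heine_fun_sums[OF adm z], of z] by simp
  then have "f sums (z * ?E z)" using sums_Suc_iff[of f "z * ?E z"] by (simp add: f_def)
  then have "?E z - ?E (of_real q * z) = z * ?E z" using f sums_unique2 by blast
  then show ?thesis by (simp add: algebra_simps)
qed

text \<open>A zero at \<open>z\<close> would propagate to all \<open>q\<^sup>k z\<close> and in the limit to \<open>0\<close>.\<close>

lemma heine_fun_000_nonzero:
  assumes z: "norm z < 1"
  shows "heine_fun q (0, 0, 0) z \<noteq> 0"
proof
  let ?E = "heine_fun q (0, 0, 0)"
  assume zero: "?E z = 0"
  have small: "norm (of_real q ^ k * z) < 1" for k
  proof -
    have "q ^ k * norm z \<le> norm z" using q by (simp add: mult_left_le_one_le power_le_one)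
    then show ?thesis using z q by (simp add: norm_mult norm_power)
  qed
  have "?E (of_real q ^ k * z) = 0" for k
  proof (induction k)
    case (Suc k)
    show ?case using heine_fun_000_functional_equation[OF small[of k]] Suc by (simp add: mult.assoc)
  qed (simp add: zero)
  moreover have "(\<lambda>k. ?E (of_real q ^ k * z)) \<longlonglongrightarrow> ?E 0"
  proof (rule continuous_on_tendsto_compose[where f = ?E and l = 0 and s = "ball 0 1"])
    have "heine_admissible q (0, 0, 0)" by (simp add: heine_admissible_def)
    then show "continuous_on (ball 0 1) ?E"
      by (intro holomorphic_on_imp_continuous_on heine_fun_holomorphic)
    have "(\<lambda>k. complex_of_real q ^ k) \<longlonglongrightarrow> 0" using q by (intro LIMSEQ_power_zero) simp
    from tendsto_mult_right[OF this, of z] show "(\<lambda>k. of_real q ^ k * z) \<longlonglongrightarrow> 0" by simp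
  qed (use small in auto)
  ultimately have "?E 0 = 0" by (simp add: LIMSEQ_const_iff)
  then show False by (simp add: heine_fun_0)
qed

text \<open>The identity \<open>z \<Phi>\<^sub>k\<^sub>+\<^sub>1(z) = \<Phi>\<^sub>k(z) F\<^sub>k(z)\<close> carries a zero of \<open>\<Phi>\<^sub>0\<close> to all \<open>\<Phi>\<^sub>k\<close>, also when
  some coefficients of the contiguous relations vanish. In the limit it would be a zero of
  \<open>\<Phi>[0,0;0;q,\<cdot>]\<close>.\<close>

lemma heine_fun_nonzero:
  assumes adm: "heine_admissible q p" and z: "z \<in> ball 0 1 \<inter> cut_plane q"
  shows "heine_fun q p z \<noteq> 0"
proof
  assume zero: "heine_fun q p z = 0"
  then have "z \<noteq> 0" using heine_fun_0[of p] by auto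
  have "heine_fun q ((heine_shift q ^^ k) p) z = 0" for k
  proof (induction k)
    case (Suc k)
    let ?p = "(heine_shift q ^^ k) p"
    obtain M :: "real measure" and X where "poles_beyond M X q"
      and ratio: "\<And>z. z \<in> ball 0 1 \<inter> cut_plane q \<Longrightarrow>
        z * heine_fun q (heine_shift q ?p) z = heine_fun q ?p z * stieltjes_transform M X z"
      by (rule heine_ratio_transform[OF heine_admissible_shifts[OF adm, of k]]) (rule that; assumption)
    then show ?case using ratio[OF z] Suc \<open>z \<noteq> 0\<close> by simp
  qed (simp add: zero)
  then have "(\<lambda>k. 0) \<longlonglongrightarrow> heine_fun q (0, 0, 0) z"
    using heine_fun_shift_limit[OF adm, of z] z by simp
  then have "heine_fun q (0, 0, 0) z = 0" by (simp add: LIMSEQ_const_iff)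
  then show False using heine_fun_000_nonzero[of z] z by simp
qed

end

theorem corollary2p8:
  fixes q a b c :: real
  assumes "0 < q" and "q < 1"
    and "0 \<le> a" and "0 \<le> b" and "0 \<le> c"
    and "0 \<le> q * (b - c)" and "q * (b - c) \<le> 1 - c * q"
    and "0 < a - c" and "a - c \<le> 1 - c"
  shows "\<exists>\<mu> :: real \<Rightarrow> real.
     \<mu> \<in> {0..1} \<rightarrow> {0..1} \<and> mono_on {0..1} \<mu> \<and> \<mu> 1 - \<mu> 0 = 1 \<and>
     (\<forall>z \<in> cut_plane q.
        stieltjes_integrable (\<lambda>t. q * z / (q - t * z)) \<mu> 0 1) \<and>
     (\<forall>z \<in> ball 0 1 \<inter> cut_plane q.
        heine_Phi a b c q z \<noteq> 0 \<and>
        z * heine_Phi a (b * q) (c * q) q z / heine_Phi a b c q z =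
          stieltjes_integral (\<lambda>t. q * z / (q - t * z)) \<mu> 0 1) \<and>
     (\<lambda>z. stieltjes_integral (\<lambda>t. q * z / (q - t * z)) \<mu> 0 1) analytic_on cut_plane q \<and>
     maps_univalently_onto_convex_imag
       (\<lambda>z. stieltjes_integral (\<lambda>t. q * z / (q - t * z)) \<mu> 0 1) {z. Re z < q} \<and>
     maps_univalently_onto_convex_imag
       (\<lambda>z. stieltjes_integral (\<lambda>t. q * z / (q - t * z)) \<mu> 0 1) (ball 0 q) \<and>
     ((\<forall>z \<in> ball 0 1. heine_Phi a b c q z \<noteq> 0) \<longrightarrow>
        maps_univalently_onto_convex_imag
          (\<lambda>z. z * heine_Phi a (b * q) (c * q) q z / heine_Phi a b c q z) (ball 0 1))"
proof -
  have q: "0 < q" "q < 1" by fact+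
  let ?p = "(a, b, c)"
  have "0 \<le> b - c" using assms(1,6) by (simp add: zero_le_mult_iff)
  then have adm: "heine_admissible q ?p"
    using assms by (auto simp: heine_admissible_def algebra_simps)
  have Phi: "heine_Phi a b c q z = heine_fun q ?p z" for z
    by (rule heine_Phi_eq_heine_fun)
  have Phi': "heine_Phi a (b * q) (c * q) q z = heine_fun q (heine_shift q ?p) z" for z
    unfolding heine_fun_def heine_shift_def heine_coeff_def heine_Phi_def
    by (simp add: mult.commute flip: of_real_mult add: q_shifted_fact_of_real)
  obtain M :: "real measure" and X where "poles_beyond M X q"
    and ratio: "\<And>z. z \<in> ball 0 1 \<inter> cut_plane q \<Longrightarrow>
       z * heine_fun q (heine_shift q ?p) z = heine_fun q ?p z * stieltjes_transform M X z"
    by (rule heine_ratio_transform[OF q adm]) (rule that; assumption)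
  interpret poles_beyond M X q by fact
  \<comment> \<open>the pole parameter \<open>X\<close> ranges over \<open>[0,1/q]\<close>, the variable \<open>t\<close> of the integral over \<open>[0,1]\<close>\<close>
  define Y where "Y \<omega> = q * X \<omega>" for \<omega>
  have Y: "Y \<in> borel_measurable M" "\<And>\<omega>. \<omega> \<in> space M \<Longrightarrow> Y \<omega> \<in> {0..1}"
    using X_range q by (auto simp: Y_def[abs_def] field_simps)
  define \<mu> where "\<mu> = jump_distribution M Y"
  define I where "I z = stieltjes_integral (\<lambda>t. q * z / (q - t * z)) \<mu> 0 1" for z :: complex
  have integral: "has_stieltjes_integral (\<lambda>t. q * z / (q - t * z)) \<mu> 0 1 (F z)"
    if z: "z \<in> cut_plane q" for z :: complex
  proof -
    have nz: "of_real q - of_real t * z \<noteq> 0" if "t \<in> {0..1}" for t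
    proof -
      have "1 - of_real (t / q) * z \<noteq> 0"
        using denominator_nonzero[OF z, of "t / q"] that q by (simp add: divide_right_mono)
      then show ?thesis using q by (auto simp: field_simps)
    qed
    have "has_stieltjes_integral (\<lambda>t. q * z / (q - t * z)) \<mu> 0 1 (\<integral>\<omega>. q * z / (q - of_real (Y \<omega>) * z) \<partial>M)"
      unfolding \<mu>_def
      by (rule has_stieltjes_integral_jump_distribution[OF Y]) (use nz in \<open>auto intro!: continuous_intros\<close>)
    also have "(\<integral>\<omega>. q * z / (q - of_real (Y \<omega>) * z) \<partial>M) = F z"
      unfolding stieltjes_transform_def
    proof (rule Bochner_Integration.integral_cong[OF refl])
      fix \<omega>
      have "of_real q - of_real (Y \<omega>) * z = of_real q * (1 - of_real (X \<omega>) * z)"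
        by (simp add: Y_def algebra_simps)
      then show "of_real q * z / (of_real q - of_real (Y \<omega>) * z) = z / (1 - of_real (X \<omega>) * z)"
        using q by simp
    qed
    finally show ?thesis .
  qed
  have IF: "I z = F z" if "z \<in> cut_plane q" for z :: complex
    unfolding I_def by (rule stieltjes_integral_eqI[OF integral[OF that]])
  have nonzero: "heine_fun q ?p z \<noteq> 0" if "z \<in> ball 0 1 \<inter> cut_plane q" for z :: complex
    by (rule heine_fun_nonzero[OF q adm that])
  have quotient: "z * heine_fun q (heine_shift q ?p) z / heine_fun q ?p z = F z"
    if "z \<in> ball 0 1 \<inter> cut_plane q" for z :: complex
    using ratio[OF that] nonzero[OF that] by simp
  have disc_sub: "ball 0 q \<subseteq> ball 0 1 \<inter> cut_plane q" by (rule slit_disc(3)[OF q])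
  show ?thesis
    unfolding Phi Phi'
  proof (intro exI[of _ \<mu>], unfold I_def[symmetric], intro conjI ballI impI)
    show "\<mu> \<in> {0..1} \<rightarrow> {0..1}" "mono_on {0..1} \<mu>" "\<mu> 1 - \<mu> 0 = 1"
      unfolding \<mu>_def using jump_distribution_properties[OF Y] by blast+
    show "stieltjes_integrable (\<lambda>t. q * z / (q - t * z)) \<mu> 0 1" if "z \<in> cut_plane q" for z :: complex
      using integral[OF that] by (auto simp: stieltjes_integrable_def)
    show "heine_fun q ?p z \<noteq> 0" if "z \<in> ball 0 1 \<inter> cut_plane q" for z
      by (rule nonzero[OF that])
    show "z * heine_fun q (heine_shift q ?p) z / heine_fun q ?p z = I z" if "z \<in> ball 0 1 \<inter> cut_plane q" for z
      using quotient[OF that] IF[of z] that by simp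
    have "I holomorphic_on cut_plane q"
      using transform_holomorphic by (rule holomorphic_transform) (simp add: IF)
    then show "I analytic_on cut_plane q"
      by (simp add: analytic_on_open[OF open_cut_plane])
    show "maps_univalently_onto_convex_imag I {z. Re z < q}"
      by (rule maps_univalently_cong[OF open_halfspace_Re_lt _ transform_halfplane])
        (simp add: IF halfplane_in_cut)
    show "maps_univalently_onto_convex_imag I (ball 0 q)"
      by (rule maps_univalently_cong[OF open_ball _ transform_disc], rule IF) (use disc_sub in auto)
    assume no_zero: "\<forall>z \<in> ball 0 1. heine_fun q ?p z \<noteq> 0"
    let ?h = "\<lambda>z. z * heine_fun q (heine_shift q ?p) z / heine_fun q ?p z"
    show "maps_univalently_onto_convex_imag ?h (ball 0 1)"
    proof (rule extension_univalent_convex)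
      show "?h holomorphic_on ball 0 1"
        using no_zero
        by (intro holomorphic_on_divide holomorphic_on_mult holomorphic_on_ident
            heine_fun_holomorphic[OF q] adm heine_admissible_shift[OF q]) blast
      show "?h z = F z" if "z \<in> ball 0 q" for z
        by (rule quotient) (rule subsetD[OF disc_sub that])
    qed (use q in simp)
  qed
qed

end
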